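(* Let $n\geq 3$ and $2\leq r\leq n$ be integers, and let $\mathcal{C}_1,\dots,\mathcal{C}_m$ denote the (distinct) conjugacy classes of $S_n$, where $\mathcal{C}_1$ is the class containing the identity element. Then $$N(n,r)=\max_{s\in\Delta_{2r}^n\setminus\{1\}}\ \sum_{i,j\in\Delta_r^n}\frac{|\mathcal{C}_i||\mathcal{C}_j|}{n!}\sum_{\chi\in\operatorname{Irr}(S_n)}\frac{\chi_i\chi_j\chi_s}{\chi_1},$$ where $\Delta_r^n$ and $\Delta_{2r}^n$ are the sets of indices in $\{1,\dots,m\}$ corresponding to the conjugacy classes whose elements move at most $r$ and at most $2r$ points, respectively.
   Context: Let $[n]=\{1,\dots,n\}$ and let $S_n$ be the group of all permutations of $[n]$; $i^\sigma$ denotes the image of $i$ under $\sigma$, and composition is $i^{\sigma\tau}=(i^\sigma)^\tau$. For $\sigma\in S_n$ let $M(\sigma)=\{i\in[n] : i^\sigma\neq i\}$ be the set of points moved by $\sigma$. The Hamming distance of $\sigma,\pi\in S_n$ is $d(\sigma,\pi)=|M(\sigma\pi^{-1})|$, and $B_r^n(\sigma)=\{\pi\in S_n : d(\sigma,\pi)\le r\}$. Define $$N(n,r)=\max\{\,|B_r^n(\pi)\cap B_r^n(\tau)| : \pi,\tau\in S_n,\ d(\pi,\tau)\ge 2\,\}.$$ $\operatorname{Irr}(S_n)$ is the set of all complex irreducible characters of $S_n$. For $\chi\in\operatorname{Irr}(S_n)$ and $i\in\{1,\dots,m\}$, $\chi_i:=\chi(\sigma)$ for any $\sigma\in\mathcal{C}_i$;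 in particular $\chi_1$ is the degree of $\chi$. *)

theory Defs
  imports
    "HOL-Algebra.Sym_Groups"
    "HOL-Algebra.Group_Action"
    "Jordan_Normal_Form.VS_Connect"
begin

text \<open>Permutations act on the right, so the product of \<open>\<sigma>\<close> and \<open>\<tau>\<close> first applies \<open>\<sigma>\<close>;
  the product of \<^const>\<open>sym_group\<close> is the opposite one.\<close>

definition symm :: "nat \<Rightarrow> (nat \<Rightarrow> nat) monoid" where
  "symm n = (sym_group n) \<lparr>mult := (\<lambda>\<sigma> \<tau>. \<tau> \<circ> \<sigma>)\<rparr>"

definition moved :: "nat \<Rightarrow> (nat \<Rightarrow> nat) \<Rightarrow> nat set" where
  "moved n \<sigma> = {i \<in> {1..n}. \<sigma> i \<noteq> i}"

definition hamming :: "nat \<Rightarrow> (nat \<Rightarrow> nat) \<Rightarrow> (nat \<Rightarrow> nat) \<Rightarrow> nat" where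
  "hamming n \<sigma> \<pi> = card (moved n (\<sigma> \<otimes>\<^bsub>symm n\<^esub> inv\<^bsub>symm n\<^esub> \<pi>))"

definition hamming_ball :: "nat \<Rightarrow> nat \<Rightarrow> (nat \<Rightarrow> nat) \<Rightarrow> (nat \<Rightarrow> nat) set" where
  "hamming_ball n r \<sigma> = {\<pi> \<in> carrier (symm n). hamming n \<sigma> \<pi> \<le> r}"

definition max_ball_intersection :: "nat \<Rightarrow> nat \<Rightarrow> nat" where
  "max_ball_intersection n r =
     Max {card (hamming_ball n r \<pi> \<inter> hamming_ball n r \<tau>) | \<pi> \<tau>.
            \<pi> \<in> carrier (symm n) \<and> \<tau> \<in> carrier (symm n) \<and> hamming n \<pi> \<tau> \<ge> 2}"

definition conjugacy_classes :: "('a, 'b) monoid_scheme \<Rightarrow> 'a set set" where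
  "conjugacy_classes G =
     orbits G (carrier G) (\<lambda>g. \<lambda>h \<in> carrier G. g \<otimes>\<^bsub>G\<^esub> h \<otimes>\<^bsub>G\<^esub> inv\<^bsub>G\<^esub> g)"

text \<open>A complex representation of degree \<open>d\<close> is a homomorphism into the general linear group,
  i.e. the units of the ring of \<open>d \<times> d\<close> matrices.\<close>

definition complex_rep ::
  "('a, 'b) monoid_scheme \<Rightarrow> nat \<Rightarrow> ('a \<Rightarrow> complex mat) \<Rightarrow> bool" where
  "complex_rep G d \<rho> \<longleftrightarrow> \<rho> \<in> hom G (units_of (ring_mat TYPE(complex) d ()))"

definition irreducible_rep ::
  "('a, 'b) monoid_scheme \<Rightarrow> nat \<Rightarrow> ('a \<Rightarrow> complex mat) \<Rightarrow> bool" where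
  "irreducible_rep G d \<rho> \<longleftrightarrow>
     complex_rep G d \<rho> \<and> 0 < d \<and>
     (\<forall>W. VectorSpace.subspace class_ring W (module_vec TYPE(complex) d) \<longrightarrow>
          (\<forall>g \<in> carrier G. \<forall>v \<in> W. \<rho> g *\<^sub>v v \<in> W) \<longrightarrow>
          W = {0\<^sub>v d} \<or> W = carrier_vec d)"

definition mat_trace :: "complex mat \<Rightarrow> complex" where
  "mat_trace A = (\<Sum>i<dim_row A. A $$ (i, i))"

text \<open>Characters are restricted to the carrier, so that distinct elements of \<open>Irr G\<close> differ
  on the group itself and sums over \<open>Irr G\<close> count every irreducible character once.\<close>

definition Irr :: "('a, 'b) monoid_scheme \<Rightarrow> ('a \<Rightarrow> complex) set" where
  "Irr G = {\<lambda>g \<in> carrier G. mat_trace (\<rho> g) | d \<rho>. irreducible_rep G d \<rho>}"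

text \<open>For \<open>\<chi>\<close> constant on \<open>K\<close>, as characters are on conjugacy classes, the choice is immaterial.\<close>

definition class_value :: "('a \<Rightarrow> complex) \<Rightarrow> 'a set \<Rightarrow> complex" where
  "class_value \<chi> K = \<chi> (SOME \<sigma>. \<sigma> \<in> K)"

definition class_indices ::
  "nat \<Rightarrow> nat \<Rightarrow> (nat \<Rightarrow> (nat \<Rightarrow> nat) set) \<Rightarrow> nat \<Rightarrow> nat set" where
  "class_indices n m C r = {i \<in> {1..m}. \<forall>\<sigma> \<in> C i. card (moved n \<sigma>) \<le> r}"

end

theory Submission
  imports Defs "Jordan_Normal_Form.Spectral_Radius"
begin

text \<open>
  For permutations \<open>\<pi>\<close>, \<open>\<tau>\<close> a common point \<open>\<sigma>\<close> of the balls of radius \<open>r\<close> around them is the same as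
  a factorization of \<open>z = \<pi>\<tau>\<^sup>-\<^sup>1\<close> into two permutations that move at most \<open>r\<close> points each
  (\<open>card_ball_intersection\<close>). Such factorizations exist only if \<open>z\<close> moves at most \<open>2r\<close> points, and
  \<open>z\<close> ranges over all non-identity permutations. The permutations that move at most \<open>r\<close> points form
  a union of conjugacy classes, so the task is to count, for two classes \<open>K\<close> and \<open>L\<close>, the pairs
  in \<open>K \<times> L\<close> with a given product. That is Frobenius' formula \<open>frobenius_class_product\<close>, which holds in
  every finite group.

  Frobenius' formula rests on two facts. First, an irreducible representation \<open>\<rho>\<close> maps
  a class sum to a scalar matrix (Schur's lemma), so that the trace of
  \<open>(\<Sum>x\<in>K. \<rho> x) (\<Sum>y\<in>L. \<rho> y) \<rho> z\<close> is a product of character values. Second,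
  \<open>\<Sum>\<chi>. \<chi>(1) \<chi>(g)\<close> is the order of the group for \<open>g = 1\<close> and \<open>0\<close> otherwise (\<open>sum_Irr_degree\<close>),
  which turns the sum of these traces over all \<open>\<chi>\<close> into a count of solutions of \<open>xyz = 1\<close>.

  The second fact is the decomposition of the regular character. Every character is a sum of
  irreducible ones, because a representation with an invariant subspace is block triangular in an
  adapted basis, its diagonal blocks are again representations, and the trace is the sum of the
  traces of the blocks. Orthogonality then determines the multiplicities.

  The formula produces the number of solutions of \<open>xy = z\<^sup>-\<^sup>1\<close>. For the symmetric group the inverse
  is harmless, since \<open>(x, y) \<mapsto> (y\<^sup>-\<^sup>1, x\<^sup>-\<^sup>1)\<close> preserves the sizes of the supports.
\<close>

section \<open>Traces and finite sums of matrices\<close>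

lemma mat_trace_mult_comm:
  assumes "A \<in> carrier_mat n m" "B \<in> carrier_mat m n"
  shows "mat_trace (A * B) = mat_trace (B * A)"
proof -
  have "mat_trace (A * B) = (\<Sum>i<n. \<Sum>j<m. A $$ (i, j) * B $$ (j, i))"
    using assms by (auto simp: mat_trace_def scalar_prod_def atLeast0LessThan intro!: sum.cong)
  also have "\<dots> = (\<Sum>j<m. \<Sum>i<n. B $$ (j, i) * A $$ (i, j))"
    by (subst sum.swap) (simp add: mult.commute)
  also have "\<dots> = mat_trace (B * A)"
    using assms by (auto simp: mat_trace_def scalar_prod_def atLeast0LessThan intro!: sum.cong)
  finally show ?thesis .
qed

lemma mat_trace_one: "mat_trace (1\<^sub>m n) = of_nat n"
  by (simp add: mat_trace_def)

lemma mat_trace_smult: "A \<in> carrier_mat n n \<Longrightarrow> mat_trace (c \<cdot>\<^sub>m A) = c * mat_trace A"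
  by (simp add: mat_trace_def sum_distrib_left)

text \<open>The type of matrices of all sizes has no common zero, so it carries no generic
  sums; fixing the format \<open>r \<times> c\<close> makes the sum total, also for empty \<open>S\<close>.\<close>

definition mat_sum ::
  "nat \<Rightarrow> nat \<Rightarrow> ('a \<Rightarrow> complex mat) \<Rightarrow> 'a set \<Rightarrow> complex mat" where
  "mat_sum r c f S = mat r c (\<lambda>ij. \<Sum>x\<in>S. f x $$ ij)"

lemma mat_sum_carrier [simp]: "mat_sum r c f S \<in> carrier_mat r c"
  and dim_mat_sum [simp]: "dim_row (mat_sum r c f S) = r" "dim_col (mat_sum r c f S) = c"
  by (simp_all add: mat_sum_def)

lemma index_mat_sum:
  "i < r \<Longrightarrow> j < c \<Longrightarrow> mat_sum r c f S $$ (i, j) = (\<Sum>x\<in>S. f x $$ (i, j))"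
  by (simp add: mat_sum_def)

lemma mat_sum_cong:
  "(\<And>x. x \<in> S \<Longrightarrow> f x = g x) \<Longrightarrow> mat_sum r c f S = mat_sum r c g S"
  by (simp add: mat_sum_def)

lemma mat_sum_reindex:
  assumes "bij_betw h S T"
  shows "mat_sum r c (\<lambda>x. f (h x)) S = mat_sum r c f T"
  unfolding mat_sum_def using sum.reindex_bij_betw[OF assms, of "\<lambda>x. f x $$ _"] by simp

lemma mult_mat_sum:
  assumes "A \<in> carrier_mat p r" "\<And>x. x \<in> S \<Longrightarrow> f x \<in> carrier_mat r c"
  shows "A * mat_sum r c f S = mat_sum p c (\<lambda>x. A * f x) S"
proof (rule eq_matI)
  fix i j assume "i < dim_row (mat_sum p c (\<lambda>x. A * f x) S)"
    "j < dim_col (mat_sum p c (\<lambda>x. A * f x) S)"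
  hence ij: "i < p" "j < c" by auto
  have "(A * mat_sum r c f S) $$ (i, j) = (\<Sum>l<r. A $$ (i, l) * (\<Sum>x\<in>S. f x $$ (l, j)))"
    using assms ij by (auto simp: scalar_prod_def atLeast0LessThan index_mat_sum intro!: sum.cong)
  also have "\<dots> = (\<Sum>x\<in>S. \<Sum>l<r. A $$ (i, l) * f x $$ (l, j))"
    by (subst sum.swap) (simp add: sum_distrib_left)
  also have "\<dots> = (\<Sum>x\<in>S. (A * f x) $$ (i, j))"
  proof (rule sum.cong[OF refl])
    fix x assume "x \<in> S"
    from assms(2)[OF this] show "(\<Sum>l<r. A $$ (i, l) * f x $$ (l, j)) = (A * f x) $$ (i, j)"
      using assms(1) ij by (auto simp: scalar_prod_def atLeast0LessThan intro!: sum.cong)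
  qed
  finally show "(A * mat_sum r c f S) $$ (i, j) = mat_sum p c (\<lambda>x. A * f x) S $$ (i, j)"
    using ij by (simp add: index_mat_sum)
qed (use assms in auto)

lemma mat_sum_mult:
  assumes "B \<in> carrier_mat c p" "\<And>x. x \<in> S \<Longrightarrow> f x \<in> carrier_mat r c"
  shows "mat_sum r c f S * B = mat_sum r p (\<lambda>x. f x * B) S"
proof (rule eq_matI)
  fix i j assume "i < dim_row (mat_sum r p (\<lambda>x. f x * B) S)"
    "j < dim_col (mat_sum r p (\<lambda>x. f x * B) S)"
  hence ij: "i < r" "j < p" by auto
  have "(mat_sum r c f S * B) $$ (i, j) = (\<Sum>l<c. (\<Sum>x\<in>S. f x $$ (i, l)) * B $$ (l, j))"
    using assms ij by (auto simp: scalar_prod_def atLeast0LessThan index_mat_sum intro!: sum.cong)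
  also have "\<dots> = (\<Sum>x\<in>S. \<Sum>l<c. f x $$ (i, l) * B $$ (l, j))"
    by (subst sum.swap) (simp add: sum_distrib_right)
  also have "\<dots> = (\<Sum>x\<in>S. (f x * B) $$ (i, j))"
  proof (rule sum.cong[OF refl])
    fix x assume "x \<in> S"
    from assms(2)[OF this] show "(\<Sum>l<c. f x $$ (i, l) * B $$ (l, j)) = (f x * B) $$ (i, j)"
      using assms(1) ij by (auto simp: scalar_prod_def atLeast0LessThan intro!: sum.cong)
  qed
  finally show "(mat_sum r c f S * B) $$ (i, j) = mat_sum r p (\<lambda>x. f x * B) S $$ (i, j)"
    using ij by (simp add: index_mat_sum)
qed (use assms in auto)

lemma mat_trace_mat_sum:
  assumes "\<And>x. x \<in> S \<Longrightarrow> f x \<in> carrier_mat r r"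
  shows "mat_trace (mat_sum r r f S) = (\<Sum>x\<in>S. mat_trace (f x))"
proof -
  have "mat_trace (mat_sum r r f S) = (\<Sum>i<r. \<Sum>x\<in>S. f x $$ (i, i))"
    by (simp add: mat_trace_def index_mat_sum)
  also have "\<dots> = (\<Sum>x\<in>S. \<Sum>i<r. f x $$ (i, i))" by (rule sum.swap)
  also have "\<dots> = (\<Sum>x\<in>S. mat_trace (f x))"
    using assms by (intro sum.cong refl) (auto simp: mat_trace_def)
  finally show ?thesis .
qed

section \<open>Representations and Schur's lemma\<close>

locale finite_group = group +
  assumes fin: "finite (carrier G)"
begin

text \<open>Invertibility of the matrices is automatic: \<open>\<rho> (inv g)\<close> is inverse to \<open>\<rho> g\<close> as soon as
  \<open>\<rho>\<close> is multiplicative and sends \<open>\<one>\<close> to the identity matrix.\<close>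

lemma complex_rep_iff:
  "complex_rep G d \<rho> \<longleftrightarrow>
     (\<forall>g\<in>carrier G. \<rho> g \<in> carrier_mat d d) \<and> \<rho> \<one> = 1\<^sub>m d \<and>
     (\<forall>g\<in>carrier G. \<forall>h\<in>carrier G. \<rho> (g \<otimes> h) = \<rho> g * \<rho> h)" (is "?L \<longleftrightarrow> ?R")
proof
  let ?M = "ring_mat TYPE(complex) d ()"
  interpret M: ring ?M by (rule ring_mat)
  {
    assume ?L
    hence h: "\<rho> \<in> hom G (units_of ?M)" by (simp add: complex_rep_def)
    interpret group_hom G "units_of ?M" \<rho>
      using h M.units_group is_group by (simp add: group_hom_def group_hom_axioms_def)
    show ?R
      using h hom_one hom_mult hom_closed
      by (auto simp: units_of_def ring_mat_simps Units_def)
  next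
    assume R: ?R
    have "\<rho> g \<in> Units ?M" if g: "g \<in> carrier G" for g
    proof -
      have "\<rho> (inv g) * \<rho> g = 1\<^sub>m d" "\<rho> g * \<rho> (inv g) = 1\<^sub>m d"
        using R g by (metis inv_closed l_inv) (metis R g inv_closed r_inv)
      thus ?thesis using R g by (auto simp: Units_def ring_mat_simps)
    qed
    thus ?L using R by (auto simp: complex_rep_def hom_def units_of_def ring_mat_simps)
  }
qed

lemma
  assumes "complex_rep G d \<rho>"
  shows rep_carrier: "g \<in> carrier G \<Longrightarrow> \<rho> g \<in> carrier_mat d d"
    and rep_one: "\<rho> \<one> = 1\<^sub>m d"
    and rep_mult: "g \<in> carrier G \<Longrightarrow> h \<in> carrier G \<Longrightarrow> \<rho> (g \<otimes> h) = \<rho> g * \<rho> h"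
  using assms by (auto simp: complex_rep_iff)

lemma irreducible_repD:
  assumes "irreducible_rep G d \<rho>"
  shows "complex_rep G d \<rho>" "0 < d"
  using assms by (auto simp: irreducible_rep_def)

lemma subspace_vecI:
  assumes "W \<subseteq> carrier_vec d" "0\<^sub>v d \<in> W"
    "\<And>v w. v \<in> W \<Longrightarrow> w \<in> W \<Longrightarrow> v + w \<in> W" "\<And>c v. v \<in> W \<Longrightarrow> c \<cdot>\<^sub>v v \<in> W"
  shows "VectorSpace.subspace class_ring W (module_vec TYPE(complex) d)"
  unfolding VectorSpace.subspace_def submodule_def
  using assms vec_vs vec_module by (auto simp: module_vec_simps)

lemma irreducible_repE:
  assumes "irreducible_rep G d \<rho>" "W \<subseteq> carrier_vec d" "0\<^sub>v d \<in> W"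
    "\<And>v w. v \<in> W \<Longrightarrow> w \<in> W \<Longrightarrow> v + w \<in> W" "\<And>c v. v \<in> W \<Longrightarrow> c \<cdot>\<^sub>v v \<in> W"
    "\<And>g v. g \<in> carrier G \<Longrightarrow> v \<in> W \<Longrightarrow> \<rho> g *\<^sub>v v \<in> W"
  shows "W = {0\<^sub>v d} \<or> W = carrier_vec d"
  using assms subspace_vecI[OF assms(2-5)] by (auto simp: irreducible_rep_def)

lemma mat_eqI_vec:
  assumes "A \<in> carrier_mat r c" "B \<in> carrier_mat r c"
    "\<And>v. v \<in> carrier_vec c \<Longrightarrow> A *\<^sub>v v = (B :: complex mat) *\<^sub>v v"
  shows "A = B"
proof (rule mat_col_eqI)
  fix j assume "j < dim_col B"
  hence j: "j < c" using assms by auto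
  have "col A j = A *\<^sub>v unit_vec c j" "col B j = B *\<^sub>v unit_vec c j"
    using assms(1,2) j by (auto intro!: eq_vecI)
  thus "col A j = col B j" using assms(3)[of "unit_vec c j"] by simp
qed (use assms in auto)

lemma mat_mult_zero_vec: "A \<in> carrier_mat r c \<Longrightarrow> A *\<^sub>v 0\<^sub>v c = (0\<^sub>v r :: complex vec)"
  by (intro eq_vecI) auto

text \<open>Kernel and image of an intertwiner are invariant subspaces, so a nonzero intertwiner is injective
  and surjective. The formats \<open>d\<close> and \<open>d'\<close> are not known to agree, which is why a
  two-sided inverse is produced; its existence lets traces be compared across the formats.\<close>

lemma schur_invertible:
  assumes irr: "irreducible_rep G d \<rho>" "irreducible_rep G d' \<rho>'"
    and T: "T \<in> carrier_mat d d'" "T \<noteq> 0\<^sub>m d d'"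
    and comm: "\<And>g. g \<in> carrier G \<Longrightarrow> \<rho> g * T = T * \<rho>' g"
  obtains S where "S \<in> carrier_mat d' d" "T * S = 1\<^sub>m d" "S * T = 1\<^sub>m d'"
proof -
  note rep = irreducible_repD(1)[OF irr(1)] and rep' = irreducible_repD(1)[OF irr(2)]
  define Ke where "Ke = {v \<in> carrier_vec d'. T *\<^sub>v v = 0\<^sub>v d}"
  define Im where "Im = {T *\<^sub>v v | v. v \<in> carrier_vec d'}"
  have comm_v: "\<rho> g *\<^sub>v (T *\<^sub>v v) = T *\<^sub>v (\<rho>' g *\<^sub>v v)"
    if "g \<in> carrier G" "v \<in> carrier_vec d'" for g v
    using that comm rep_carrier[OF rep] rep_carrier[OF rep'] T
    by (metis assoc_mult_mat_vec)
  have "Ke = {0\<^sub>v d'} \<or> Ke = carrier_vec d'"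
  proof (rule irreducible_repE[OF irr(2)])
    fix g v assume gv: "g \<in> carrier G" "v \<in> Ke"
    hence v: "v \<in> carrier_vec d'" "T *\<^sub>v v = 0\<^sub>v d" by (auto simp: Ke_def)
    have "T *\<^sub>v (\<rho>' g *\<^sub>v v) = 0\<^sub>v d"
      using comm_v[OF gv(1) v(1)] v(2) mat_mult_zero_vec[OF rep_carrier[OF rep gv(1)]] by simp
    thus "\<rho>' g *\<^sub>v v \<in> Ke" using v rep_carrier[OF rep' gv(1)] by (auto simp: Ke_def)
  qed (use T in \<open>auto simp: Ke_def mult_add_distrib_mat_vec mult_mat_vec\<close>)
  moreover have "Ke \<noteq> carrier_vec d'"
  proof
    assume "Ke = carrier_vec d'"
    hence "T *\<^sub>v v = 0\<^sub>v d" if "v \<in> carrier_vec d'" for v using that by (auto simp: Ke_def)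
    moreover have "0\<^sub>m d d' *\<^sub>v v = (0\<^sub>v d :: complex vec)" if "v \<in> carrier_vec d'" for v
      using that by (intro eq_vecI) auto
    ultimately have "T = 0\<^sub>m d d'" by (intro mat_eqI_vec[OF T(1)]) auto
    thus False using T by simp
  qed
  ultimately have Ke0: "Ke = {0\<^sub>v d'}" by simp
  have "Im = {0\<^sub>v d} \<or> Im = carrier_vec d"
  proof (rule irreducible_repE[OF irr(1)])
    show "0\<^sub>v d \<in> Im" using T by (force simp: Im_def intro!: exI[of _ "0\<^sub>v d'"])
    show "v + w \<in> Im" if "v \<in> Im" "w \<in> Im" for v w
      using that T unfolding Im_def
      by (smt (verit) add_carrier_vec mem_Collect_eq mult_add_distrib_mat_vec)
    show "c \<cdot>\<^sub>v v \<in> Im" if "v \<in> Im" for c v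
      using that T unfolding Im_def
      by (smt (verit) smult_carrier_vec mem_Collect_eq mult_mat_vec)
    show "\<rho> g *\<^sub>v v \<in> Im" if "g \<in> carrier G" "v \<in> Im" for g v
      using that comm_v rep_carrier[OF rep'] unfolding Im_def
      by (smt (verit) mem_Collect_eq mult_mat_vec_carrier)
  qed (use T in \<open>auto simp: Im_def\<close>)
  moreover have "Im \<noteq> {0\<^sub>v d}"
  proof
    assume "Im = {0\<^sub>v d}"
    hence "Ke = carrier_vec d'" by (auto simp: Im_def Ke_def)
    thus False using \<open>Ke \<noteq> carrier_vec d'\<close> by simp
  qed
  ultimately have Im1: "Im = carrier_vec d" by simp
  have "\<exists>u. u \<in> carrier_vec d' \<and> T *\<^sub>v u = unit_vec d j" for j
  proof -
    have "unit_vec d j \<in> Im" unfolding Im1 by simp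
    then obtain u where "u \<in> carrier_vec d'" "unit_vec d j = T *\<^sub>v u" unfolding Im_def by auto
    thus ?thesis by (intro exI[of _ u]) simp
  qed
  then obtain u where u: "\<And>j. u j \<in> carrier_vec d'" "\<And>j. T *\<^sub>v u j = unit_vec d j" by metis
  define S where "S = mat d' d (\<lambda>(i, j). u j $ i)"
  have S: "S \<in> carrier_mat d' d" by (simp add: S_def)
  have colS: "col S j = u j" if "j < d" for j
    using that u(1)[of j] by (intro eq_vecI) (auto simp: S_def)
  have TS: "T * S = 1\<^sub>m d"
  proof (rule mat_col_eqI)
    fix j assume "j < dim_col (1\<^sub>m d :: complex mat)"
    hence j: "j < d" by simp
    have "col (T * S) j = T *\<^sub>v col S j" using T S j by (intro col_mult2) auto
    thus "col (T * S) j = col (1\<^sub>m d) j" using j colS u by simp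
  qed (use T S in auto)
  have "S * T = 1\<^sub>m d'"
  proof (rule mat_eqI_vec)
    fix v :: "complex vec" assume v: "v \<in> carrier_vec d'"
    let ?w = "(S * T) *\<^sub>v v - v"
    have STv: "(S * T) *\<^sub>v v \<in> carrier_vec d'" using S T v by auto
    have "T *\<^sub>v ?w = T *\<^sub>v ((S * T) *\<^sub>v v) - T *\<^sub>v v"
      using T v STv by (intro mult_minus_distrib_mat_vec) auto
    also have "T *\<^sub>v ((S * T) *\<^sub>v v) = (T * S) *\<^sub>v (T *\<^sub>v v)"
      using T S v by (simp add: assoc_mult_mat_vec[of _ _ d' _ d] assoc_mult_mat_vec[of _ _ d])
    also have "\<dots> = T *\<^sub>v v" using T v by (simp add: TS)
    finally have "T *\<^sub>v ?w = 0\<^sub>v d" using T v by auto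
    hence "?w \<in> Ke" using v STv by (auto simp: Ke_def)
    hence w0: "?w = 0\<^sub>v d'" using Ke0 by simp
    have "(S * T) *\<^sub>v v = ?w + v" using STv v S by (intro eq_vecI) auto
    hence "(S * T) *\<^sub>v v = v" using w0 v by simp
    thus "(S * T) *\<^sub>v v = 1\<^sub>m d' *\<^sub>v v" using v by simp
  qed (use S T in auto)
  with S TS show ?thesis by (rule that)
qed

text \<open>Subtracting an eigenvalue leaves an intertwiner with nontrivial kernel, which must vanish.
  The scalar is then read off from the trace.\<close>

lemma schur_scalar:
  assumes irr: "irreducible_rep G d \<rho>" and T: "T \<in> carrier_mat d d"
    and comm: "\<And>g. g \<in> carrier G \<Longrightarrow> \<rho> g * T = T * \<rho> g"
  shows "T = (mat_trace T / of_nat d) \<cdot>\<^sub>m 1\<^sub>m d"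
proof -
  note rep = irreducible_repD(1)[OF irr] and d = irreducible_repD(2)[OF irr]
  obtain c where "eigenvalue T c"
    using spectrum_non_empty[OF T d] by (auto simp: spectrum_def)
  then obtain v where v: "v \<in> carrier_vec d" "v \<noteq> 0\<^sub>v d" "T *\<^sub>v v = c \<cdot>\<^sub>v v"
    using T by (auto simp: eigenvalue_def eigenvector_def)
  \<comment> \<open>\<open>U\<close> also intertwines and kills the eigenvector \<open>v\<close>, so it has no inverse.\<close>
  define U where "U = T - c \<cdot>\<^sub>m 1\<^sub>m d"
  have U: "U \<in> carrier_mat d d" unfolding U_def by (intro minus_carrier_mat) simp
  have "U = 0\<^sub>m d d"
  proof (rule ccontr)
    assume "U \<noteq> 0\<^sub>m d d"
    moreover have "\<rho> g * U = U * \<rho> g" if g: "g \<in> carrier G" for g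
    proof -
      note R = rep_carrier[OF rep g]
      have "\<rho> g * U = \<rho> g * T - \<rho> g * (c \<cdot>\<^sub>m 1\<^sub>m d)"
        unfolding U_def using R T by (intro mult_minus_distrib_mat) auto
      also have "\<dots> = T * \<rho> g - (c \<cdot>\<^sub>m 1\<^sub>m d) * \<rho> g"
        using comm[OF g] R by (simp add: mult_smult_distrib[OF R one_carrier_mat] mult_smult_assoc_mat[OF one_carrier_mat R])
      also have "\<dots> = U * \<rho> g"
        unfolding U_def using R T by (intro minus_mult_distrib_mat[symmetric]) auto
      finally show ?thesis .
    qed
    ultimately obtain S where S: "S \<in> carrier_mat d d" "S * U = 1\<^sub>m d"
      using schur_invertible[OF irr irr U] by metis
    have "U *\<^sub>v v = T *\<^sub>v v - (c \<cdot>\<^sub>m 1\<^sub>m d) *\<^sub>v v"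
      unfolding U_def using T v by (intro minus_mult_distrib_mat_vec) auto
    also have "\<dots> = 0\<^sub>v d" using v by (intro eq_vecI) auto
    finally have "S *\<^sub>v (U *\<^sub>v v) = 0\<^sub>v d" using mat_mult_zero_vec[OF S(1)] by simp
    moreover have "S *\<^sub>v (U *\<^sub>v v) = (S * U) *\<^sub>v v"
      by (rule assoc_mult_mat_vec[OF S(1) U v(1), symmetric])
    ultimately show False using v S by simp
  qed
  hence Tc: "T = c \<cdot>\<^sub>m 1\<^sub>m d"
  proof -
    have "T = U + c \<cdot>\<^sub>m 1\<^sub>m d" using T by (intro eq_matI) (auto simp: U_def)
    thus ?thesis using \<open>U = 0\<^sub>m d d\<close> by simp
  qed
  have "mat_trace T = c * of_nat d"
    unfolding Tc by (subst mat_trace_smult[OF one_carrier_mat]) (simp add: mat_trace_one)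
  thus ?thesis using Tc d by simp
qed

end

section \<open>Orthogonality of characters\<close>

context finite_group
begin

lemma bij_mult_left: "a \<in> carrier G \<Longrightarrow> bij_betw (\<lambda>x. a \<otimes> x) (carrier G) (carrier G)"
  by (rule bij_betw_byWitness[where f' = "\<lambda>x. inv a \<otimes> x"]) (auto simp: m_assoc[symmetric])

text \<open>Summing conjugates over the group turns an arbitrary matrix into an intertwiner, because left
  translation by \<open>h\<close> permutes the summands.\<close>

lemma averaged_matrix_intertwines:
  assumes irr: "irreducible_rep G d \<rho>" "irreducible_rep G d' \<rho>'" and E: "E \<in> carrier_mat d d'"
  defines "T \<equiv> mat_sum d d' (\<lambda>g. \<rho> g * E * \<rho>' (inv g)) (carrier G)"
  assumes h: "h \<in> carrier G"
  shows "\<rho> h * T = T * \<rho>' h"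
proof -
  note R = rep_carrier[OF irreducible_repD(1)[OF irr(1)]] and m = rep_mult[OF irreducible_repD(1)[OF irr(1)]]
   and R' = rep_carrier[OF irreducible_repD(1)[OF irr(2)]] and m' = rep_mult[OF irreducible_repD(1)[OF irr(2)]]
  have c: "\<rho> g * E * \<rho>' (inv g) \<in> carrier_mat d d'" if "g \<in> carrier G" for g
    using R[OF that] R'[of "inv g"] that E by auto
  have "\<rho> h * T = mat_sum d d' (\<lambda>g. \<rho> h * (\<rho> g * E * \<rho>' (inv g))) (carrier G)"
    unfolding T_def by (rule mult_mat_sum[OF R[OF h] c])
  also have "\<dots> = mat_sum d d' (\<lambda>g. \<rho> (h \<otimes> g) * E * \<rho>' (inv (h \<otimes> g)) * \<rho>' h) (carrier G)"
  proof (rule mat_sum_cong)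
    fix g assume g: "g \<in> carrier G"
    have "inv (h \<otimes> g) \<otimes> h = inv g" using g h by (simp add: inv_mult_group m_assoc)
    hence 1: "\<rho>' (inv g) = \<rho>' (inv (h \<otimes> g)) * \<rho>' h" using m'[of "inv (h \<otimes> g)" h] g h by simp
    have "\<rho> (h \<otimes> g) * E * \<rho>' (inv (h \<otimes> g)) * \<rho>' h = (\<rho> (h \<otimes> g) * E) * (\<rho>' (inv (h \<otimes> g)) * \<rho>' h)"
      using g h by (intro assoc_mult_mat[of _ d d' _ d' _ d'] mult_carrier_mat[OF R E] R') auto
    also have "\<dots> = (\<rho> h * (\<rho> g * E)) * \<rho>' (inv g)"
      unfolding 1[symmetric] m[OF h g] by (simp add: assoc_mult_mat[OF R[OF h] R[OF g] E])
    also have "\<dots> = \<rho> h * (\<rho> g * E * \<rho>' (inv g))"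
      using g by (intro assoc_mult_mat[OF R[OF h] mult_carrier_mat[OF R[OF g] E] R']) simp
    finally show "\<rho> h * (\<rho> g * E * \<rho>' (inv g)) = \<rho> (h \<otimes> g) * E * \<rho>' (inv (h \<otimes> g)) * \<rho>' h" ..
  qed
  also have "\<dots> = mat_sum d d' (\<lambda>g. \<rho> g * E * \<rho>' (inv g) * \<rho>' h) (carrier G)"
    by (rule mat_sum_reindex[OF bij_mult_left[OF h], where f = "\<lambda>g. \<rho> g * E * \<rho>' (inv g) * \<rho>' h"])
  also have "\<dots> = T * \<rho>' h"
    unfolding T_def by (rule mat_sum_mult[OF R'[OF h] c, symmetric])
  finally show ?thesis .
qed

lemma index_mult_matrix_unit_mult:
  fixes A B :: "complex mat"
  assumes "A \<in> carrier_mat p d" "B \<in> carrier_mat d' q" "i < d" "k < d'" "a < p" "b < q"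
  shows "(A * mat d d' (\<lambda>(x, y). of_bool (x = i \<and> y = k)) * B) $$ (a, b) = A $$ (a, i) * B $$ (k, b)"
proof -
  let ?E = "mat d d' (\<lambda>(x, y). of_bool (x = i \<and> y = k)) :: complex mat"
  have AE: "(A * ?E) $$ (a, y) = (if y = k then A $$ (a, i) else 0)" if "y < d'" for y
  proof -
    have "(A * ?E) $$ (a, y) = (\<Sum>x<d. A $$ (a, x) * of_bool (x = i \<and> y = k))"
      using assms that by (auto simp: scalar_prod_def atLeast0LessThan intro!: sum.cong)
    also have "\<dots> = (\<Sum>x<d. if x = i then (if y = k then A $$ (a, i) else 0) else 0)"
      by (intro sum.cong) auto
    finally show ?thesis using assms by simp
  qed
  have "(A * ?E * B) $$ (a, b) = (\<Sum>y<d'. (A * ?E) $$ (a, y) * B $$ (y, b))"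
    using assms by (auto simp: scalar_prod_def atLeast0LessThan intro!: sum.cong)
  also have "\<dots> = (\<Sum>y<d'. if y = k then A $$ (a, i) * B $$ (k, b) else 0)"
    by (intro sum.cong) (auto simp: AE)
  finally show ?thesis using assms by simp
qed

text \<open>A product of two traces is a sum of products of diagonal entries, and each such product is an
  entry of a conjugated matrix unit. Hence the inner product of two characters only
  involves averaged matrices, to which Schur's lemma applies.\<close>

lemma sum_trace_prod_eq:
  assumes irr: "irreducible_rep G d \<rho>" "irreducible_rep G d' \<rho>'"
  defines "T \<equiv> \<lambda>E. mat_sum d d' (\<lambda>g. \<rho> g * E * \<rho>' (inv g)) (carrier G)"
  shows "(\<Sum>g\<in>carrier G. mat_trace (\<rho> g) * mat_trace (\<rho>' (inv g))) =
    (\<Sum>i<d. \<Sum>k<d'. T (mat d d' (\<lambda>(x, y). of_bool (x = i \<and> y = k))) $$ (i, k))"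
proof -
  note R = rep_carrier[OF irreducible_repD(1)[OF irr(1)]]
   and R' = rep_carrier[OF irreducible_repD(1)[OF irr(2)]]
  have "(\<Sum>i<d. \<Sum>k<d'. T (mat d d' (\<lambda>(x, y). of_bool (x = i \<and> y = k))) $$ (i, k)) =
    (\<Sum>i<d. \<Sum>k<d'. \<Sum>g\<in>carrier G. \<rho> g $$ (i, i) * \<rho>' (inv g) $$ (k, k))"
    unfolding T_def
    by (intro sum.cong refl) (auto simp: index_mat_sum index_mult_matrix_unit_mult[OF R R'] intro!: sum.cong)
  also have "\<dots> = (\<Sum>g\<in>carrier G. \<Sum>i<d. \<Sum>k<d'. \<rho> g $$ (i, i) * \<rho>' (inv g) $$ (k, k))"
    by (subst (2) sum.swap) (subst sum.swap, simp)
  also have "\<dots> = (\<Sum>g\<in>carrier G. mat_trace (\<rho> g) * mat_trace (\<rho>' (inv g)))"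
    using carrier_matD[OF R] carrier_matD[OF R']
    by (intro sum.cong refl) (simp add: mat_trace_def sum_product)
  finally show ?thesis ..
qed

text \<open>The averaged matrix unit at \<open>(i, k)\<close> is a scalar matrix whose trace is the order of
  the group if \<open>i = k\<close> and \<open>0\<close> otherwise, so only the \<open>d\<close> diagonal units contribute, each the
  order divided by \<open>d\<close>.\<close>

lemma character_orthogonality_same:
  assumes irr: "irreducible_rep G d \<rho>"
  shows "(\<Sum>g\<in>carrier G. mat_trace (\<rho> g) * mat_trace (\<rho> (inv g))) = of_nat (card (carrier G))"
proof -
  note rep = irreducible_repD(1)[OF irr]
  note R = rep_carrier[OF rep] and d = irreducible_repD(2)[OF irr]
  define T where "T = (\<lambda>E. mat_sum d d (\<lambda>g. \<rho> g * E * \<rho> (inv g)) (carrier G))"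
  have tr: "mat_trace (T E) = of_nat (card (carrier G)) * mat_trace E" if E: "E \<in> carrier_mat d d" for E
  proof -
    have "mat_trace (T E) = (\<Sum>g\<in>carrier G. mat_trace (\<rho> g * E * \<rho> (inv g)))"
      unfolding T_def by (intro mat_trace_mat_sum mult_carrier_mat[OF mult_carrier_mat[OF R E] R]) auto
    also have "\<dots> = (\<Sum>g\<in>carrier G. mat_trace E)"
    proof (rule sum.cong[OF refl])
      fix g assume g: "g \<in> carrier G"
      hence g': "inv g \<in> carrier G" by simp
      have "mat_trace (\<rho> g * E * \<rho> (inv g)) = mat_trace (\<rho> (inv g) * (\<rho> g * E))"
        using R[OF g] R[OF g'] E by (intro mat_trace_mult_comm) auto
      also have "\<rho> (inv g) * (\<rho> g * E) = \<rho> (inv g) * \<rho> g * E"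
        by (rule assoc_mult_mat[OF R[OF g'] R[OF g] E, symmetric])
      also have "\<dots> = E" using E g by (simp add: rep_mult[OF rep, symmetric] rep_one[OF rep])
      finally show "mat_trace (\<rho> g * E * \<rho> (inv g)) = mat_trace E" .
    qed
    finally show ?thesis by simp
  qed
  have scal: "T E = (of_nat (card (carrier G)) * mat_trace E / of_nat d) \<cdot>\<^sub>m 1\<^sub>m d" if E: "E \<in> carrier_mat d d" for E
    unfolding tr[OF E, symmetric]
    by (rule schur_scalar[OF irr])
       (use averaged_matrix_intertwines[OF irr irr E] in \<open>auto simp: T_def\<close>)
  have trE: "mat_trace (mat d d (\<lambda>(x, y). of_bool (x = i \<and> y = k))) = of_bool (i = k)"
    if "i < d" "k < d" for i k
  proof -
    have "mat_trace (mat d d (\<lambda>(x, y). of_bool (x = i \<and> y = k))) = (\<Sum>x<d. if x = i then of_bool (i = k) else 0)"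
      unfolding mat_trace_def dim_row_mat by (intro sum.cong) auto
    thus ?thesis using that by simp
  qed
  have "(\<Sum>g\<in>carrier G. mat_trace (\<rho> g) * mat_trace (\<rho> (inv g))) =
     (\<Sum>i<d. \<Sum>k<d. T (mat d d (\<lambda>(x, y). of_bool (x = i \<and> y = k))) $$ (i, k))"
    unfolding T_def by (rule sum_trace_prod_eq[OF irr irr])
  also have "\<dots> = (\<Sum>i<d. \<Sum>k<d. if k = i then of_nat (card (carrier G)) / of_nat d else 0)"
    by (intro sum.cong refl) (auto simp: scal trE)
  also have "\<dots> = of_nat (card (carrier G))" using d by simp
  finally show ?thesis .
qed

text \<open>If some averaged matrix is nonzero, it is invertible and conjugates one representation into the
  other, so the characters agree. Otherwise all averages vanish, and with them the sum.\<close>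

lemma character_orthogonality:
  assumes irr: "irreducible_rep G d \<rho>" "irreducible_rep G d' \<rho>'"
  shows "(\<Sum>g\<in>carrier G. mat_trace (\<rho> g) * mat_trace (\<rho>' (inv g))) =
    (if \<forall>g\<in>carrier G. mat_trace (\<rho> g) = mat_trace (\<rho>' g) then of_nat (card (carrier G)) else 0)"
proof (cases "\<forall>g\<in>carrier G. mat_trace (\<rho> g) = mat_trace (\<rho>' g)")
  case True
  hence "(\<Sum>g\<in>carrier G. mat_trace (\<rho> g) * mat_trace (\<rho>' (inv g))) =
    (\<Sum>g\<in>carrier G. mat_trace (\<rho> g) * mat_trace (\<rho> (inv g)))" by (intro sum.cong refl) auto
  thus ?thesis using True character_orthogonality_same[OF irr(1)] by simp
next
  case False
  note R = rep_carrier[OF irreducible_repD(1)[OF irr(1)]]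
   and R' = rep_carrier[OF irreducible_repD(1)[OF irr(2)]]
  define T where "T = (\<lambda>E. mat_sum d d' (\<lambda>g. \<rho> g * E * \<rho>' (inv g)) (carrier G))"
  have Tc: "T E \<in> carrier_mat d d'" for E by (simp add: T_def)
  have T0: "T E = 0\<^sub>m d d'" if E: "E \<in> carrier_mat d d'" for E
  proof (rule ccontr)
    assume ne: "T E \<noteq> 0\<^sub>m d d'"
    have comm: "\<rho> g * T E = T E * \<rho>' g" if "g \<in> carrier G" for g
      using averaged_matrix_intertwines[OF irr E that] by (simp add: T_def)
    obtain S where S: "S \<in> carrier_mat d' d" "T E * S = 1\<^sub>m d" "S * T E = 1\<^sub>m d'"
      using schur_invertible[OF irr Tc ne comm] by blast
    have "mat_trace (\<rho> g) = mat_trace (\<rho>' g)" if g: "g \<in> carrier G" for g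
    proof -
      note Rg = R[OF g] and R'g = R'[OF g]
      have "\<rho> g = \<rho> g * (T E * S)" using Rg S(2) by simp
      also have "\<dots> = T E * \<rho>' g * S"
        unfolding comm[OF g, symmetric] by (rule assoc_mult_mat[OF Rg Tc S(1), symmetric])
      also have "mat_trace \<dots> = mat_trace (S * (T E * \<rho>' g))"
        by (rule mat_trace_mult_comm[OF mult_carrier_mat[OF Tc R'g] S(1)])
      also have "S * (T E * \<rho>' g) = S * T E * \<rho>' g"
        by (rule assoc_mult_mat[OF S(1) Tc R'g, symmetric])
      also have "\<dots> = \<rho>' g" using S(3) R'g by simp
      finally show ?thesis .
    qed
    thus False using False by blast
  qed
  have "(\<Sum>g\<in>carrier G. mat_trace (\<rho> g) * mat_trace (\<rho>' (inv g))) =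
     (\<Sum>i<d. \<Sum>k<d'. T (mat d d' (\<lambda>(x, y). of_bool (x = i \<and> y = k))) $$ (i, k))"
    unfolding T_def by (rule sum_trace_prod_eq[OF irr])
  also have "\<dots> = 0" by (intro sum.neutral ballI) (simp add: T0)
  finally show ?thesis using False by auto
qed

lemma Irr_orthogonality:
  assumes "\<psi> \<in> Irr G" "\<chi> \<in> Irr G"
  shows "(\<Sum>g\<in>carrier G. \<psi> g * \<chi> (inv g)) = (if \<psi> = \<chi> then of_nat (card (carrier G)) else 0)"
proof -
  obtain d \<rho> d' \<rho>' where *: "irreducible_rep G d \<rho>" "\<psi> = (\<lambda>g\<in>carrier G. mat_trace (\<rho> g))"
    "irreducible_rep G d' \<rho>'" "\<chi> = (\<lambda>g\<in>carrier G. mat_trace (\<rho>' g))"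
    using assms by (auto simp: Irr_def)
  have "\<psi> = \<chi> \<longleftrightarrow> (\<forall>g\<in>carrier G. mat_trace (\<rho> g) = mat_trace (\<rho>' g))"
    unfolding * by (auto simp: fun_eq_iff restrict_def)
  thus ?thesis using character_orthogonality[OF *(1,3)] by (simp add: *(2,4) cong: sum.cong)
qed

end

section \<open>Every character is a sum of irreducible ones\<close>

lemma index_mult_mat_eq_sum:
  assumes "A \<in> carrier_mat n m" "B \<in> carrier_mat m p" "i < n" "j < p"
  shows "(A * B) $$ (i, j) = (\<Sum>l<m. A $$ (i, l) * B $$ (l, j))"
  using assms by (auto simp: scalar_prod_def atLeast0LessThan intro!: sum.cong)

lemma index_mult_mat_vec_eq_sum:
  assumes "A \<in> carrier_mat n m" "v \<in> carrier_vec m" "i < n"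
  shows "(A *\<^sub>v v) $ i = (\<Sum>l<m. A $$ (i, l) * v $ l)"
  using assms by (auto simp: scalar_prod_def atLeast0LessThan intro!: sum.cong)

text \<open>One step of the construction of a basis adapted to \<open>W\<close>: the first \<open>k\<close> columns of \<open>P\<close> lie in
  \<open>W\<close>, and \<open>w \<in> W\<close> has a nonzero coordinate at a position \<open>i \<ge> k\<close>. Moving column \<open>k\<close> to
  position \<open>i\<close> and putting \<open>w\<close> at position \<open>k\<close> keeps the columns a basis and lengthens the part
  inside \<open>W\<close>. The matrix \<open>E\<close> performs this exchange on coordinates.\<close>

lemma exchange_column:
  fixes P :: "complex mat"
  assumes P: "P \<in> carrier_mat d d" "Q \<in> carrier_mat d d" "P * Q = 1\<^sub>m d"
    and W: "W \<subseteq> carrier_vec d"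
      "\<And>v w. v \<in> W \<Longrightarrow> w \<in> W \<Longrightarrow> v + w \<in> W" "\<And>c v. v \<in> W \<Longrightarrow> c \<cdot>\<^sub>v v \<in> W"
    and k: "k \<le> i" "i < d"
    and sub: "\<And>v. v \<in> carrier_vec d \<Longrightarrow> \<forall>j<d. k \<le> j \<longrightarrow> v $ j = 0 \<Longrightarrow> P *\<^sub>v v \<in> W"
    and w: "w \<in> W" "(Q *\<^sub>v w) $ i \<noteq> 0"
  shows "\<exists>P' Q'. P' \<in> carrier_mat d d \<and> Q' \<in> carrier_mat d d \<and> P' * Q' = 1\<^sub>m d \<and>
    (\<forall>v \<in> carrier_vec d. (\<forall>j<d. Suc k \<le> j \<longrightarrow> v $ j = 0) \<longrightarrow> P' *\<^sub>v v \<in> W)"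
proof -
  have QP: "Q * P = 1\<^sub>m d" by (rule mat_mult_left_right_inverse[OF P])
  define u where "u = Q *\<^sub>v w"
  have u: "u \<in> carrier_vec d" "u $ i \<noteq> 0" and wc: "w \<in> carrier_vec d" using P w W by (auto simp: u_def)
  have Pu: "P *\<^sub>v u = w" using P wc by (simp add: u_def assoc_mult_mat_vec[symmetric, of _ d d _ d])
  define E :: "complex mat" where
    "E = mat d d (\<lambda>(a, b). if b = k then u $ a else if b = i then of_bool (a = k) else of_bool (a = b))"
  have E: "E \<in> carrier_mat d d" by (simp add: E_def)
  have Ev: "(E *\<^sub>v v) $ a = u $ a * v $ k +
      (if a = k then (if i \<noteq> k then v $ i else 0) else if a = i then 0 else v $ a)"
    if "v \<in> carrier_vec d" "a < d" for v a
  proof -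
    have "(E *\<^sub>v v) $ a = (\<Sum>b<d. (if b = k then u $ a * v $ k else 0) +
       (if b = (if a = k then i else a) then (if a = k then (if i \<noteq> k then v $ i else 0) else if a = i then 0 else v $ a) else 0))"
      unfolding index_mult_mat_vec_eq_sum[OF E that]
      using that k by (intro sum.cong refl) (auto simp: E_def)
    also have "\<dots> = u $ a * v $ k +
      (if a = k then (if i \<noteq> k then v $ i else 0) else if a = i then 0 else v $ a)"
      using k that by (subst sum.distrib) simp
    finally show ?thesis .
  qed
  \<comment> \<open>Row \<open>i\<close> of \<open>E\<close> has \<open>u $ i\<close> in column \<open>k\<close> and zeros elsewhere; that entry being nonzero
    makes \<open>E\<close> injective.\<close>
  have "det E \<noteq> 0"
  proof
    assume "det E = 0"
    then obtain v where v: "v \<in> carrier_vec d" "v \<noteq> 0\<^sub>v d" "E *\<^sub>v v = 0\<^sub>v d"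
      using det_0_iff_vec_prod_zero_field[OF E] by auto
    have z: "u $ a * v $ k + (if a = k then (if i \<noteq> k then v $ i else 0) else if a = i then 0 else v $ a) = 0"
      if "a < d" for a using Ev[OF v(1) that] v(3) that by simp
    have vk: "v $ k = 0" using z[of i] u k by (auto split: if_splits)
    have "v $ a = 0" if "a < d" for a
      using z[OF that] z[of k] vk k by (auto split: if_splits)
    hence "v = 0\<^sub>v d" using v(1) by (intro eq_vecI) auto
    thus False using v by simp
  qed
  from det_non_zero_imp_unit[OF E this, of "()"]
  obtain F where F: "F \<in> carrier_mat d d" "E * F = 1\<^sub>m d"
    by (auto simp: Units_def ring_mat_simps)
  have "(P * E) * (F * Q) = P * (E * F) * Q"
    using assoc_mult_mat[OF mult_carrier_mat[OF P(1) E] F(1) P(2)] assoc_mult_mat[OF P(1) E F(1)] by simp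
  also have "\<dots> = 1\<^sub>m d" using F P by simp
  finally have inv: "(P * E) * (F * Q) = 1\<^sub>m d" .
  have "(P * E) *\<^sub>v v \<in> W" if v: "v \<in> carrier_vec d" "\<forall>j<d. Suc k \<le> j \<longrightarrow> v $ j = 0" for v
  proof -
    define v' where "v' = vec d (\<lambda>j. if j < k then v $ j else 0)"
    have v': "v' \<in> carrier_vec d" by (simp add: v'_def)
    have "E *\<^sub>v v = v $ k \<cdot>\<^sub>v u + v'"
    proof (rule eq_vecI)
      fix a assume "a < dim_vec (v $ k \<cdot>\<^sub>v u + v')"
      hence a: "a < d" using v' by simp
      have "v $ i = 0 \<or> i = k" using v k by (metis le_neq_implies_less Suc_leI)
      moreover have "v $ a = 0 \<or> a \<le> k" using v(2) a by (meson not_less_eq_eq)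
      ultimately show "(E *\<^sub>v v) $ a = (v $ k \<cdot>\<^sub>v u + v') $ a"
        unfolding Ev[OF v(1) a] using a u k by (auto simp: v'_def)
    qed (use E u v' in auto)
    hence "(P * E) *\<^sub>v v = P *\<^sub>v (v $ k \<cdot>\<^sub>v u + v')"
      using P E v by (simp add: assoc_mult_mat_vec[of _ d d _ d])
    also have "\<dots> = P *\<^sub>v (v $ k \<cdot>\<^sub>v u) + P *\<^sub>v v'"
      using P u v' by (intro mult_add_distrib_mat_vec) auto
    also have "P *\<^sub>v (v $ k \<cdot>\<^sub>v u) = v $ k \<cdot>\<^sub>v w" using mult_mat_vec[OF P(1) u(1)] Pu by simp
    finally show ?thesis using W w sub[OF v'] by (auto simp: v'_def)
  qed
  with inv P E F show ?thesis
    by (intro exI[of _ "P * E"] exI[of _ "F * Q"]) auto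
qed

text \<open>A basis of the whole space with as many leading columns in \<open>W\<close> as possible: no vector of
  \<open>W\<close> can have a nonzero coordinate beyond them, since \<open>exchange_column\<close> would extend the leading part.\<close>

lemma adapted_basis:
  assumes W: "W \<subseteq> carrier_vec d" "0\<^sub>v d \<in> W"
      "\<And>v w. v \<in> W \<Longrightarrow> w \<in> W \<Longrightarrow> v + w \<in> W" "\<And>c v. v \<in> W \<Longrightarrow> c \<cdot>\<^sub>v v \<in> W"
  obtains k and P Q :: "complex mat" where "P \<in> carrier_mat d d" "Q \<in> carrier_mat d d"
    "P * Q = 1\<^sub>m d" "Q * P = 1\<^sub>m d" "k \<le> d"
    "\<And>v. v \<in> carrier_vec d \<Longrightarrow> P *\<^sub>v v \<in> W \<longleftrightarrow> (\<forall>j<d. k \<le> j \<longrightarrow> v $ j = 0)"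
proof -
  define good where "good k \<longleftrightarrow> k \<le> d \<and> (\<exists>P Q. P \<in> carrier_mat d d \<and> Q \<in> carrier_mat d d \<and>
     P * Q = 1\<^sub>m d \<and> (\<forall>v \<in> carrier_vec d. (\<forall>j<d. k \<le> j \<longrightarrow> v $ j = 0) \<longrightarrow> P *\<^sub>v v \<in> W))" for k
  have good0: "good 0"
  proof -
    have "v = 0\<^sub>v d" if "v \<in> carrier_vec d" "\<forall>j<d. v $ j = 0" for v :: "complex vec"
      using that by (intro eq_vecI) auto
    hence "1\<^sub>m d *\<^sub>v v \<in> W" if "v \<in> carrier_vec d" "\<forall>j<d. 0 \<le> j \<longrightarrow> v $ j = 0" for v :: "complex vec"
      using that W(2) by simp
    thus ?thesis unfolding good_def
      by (intro conjI exI[of _ "1\<^sub>m d"] ballI impI) auto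
  qed
  have bound: "\<And>k. good k \<Longrightarrow> k \<le> d" by (simp add: good_def)
  have g: "good (Greatest good)" and max: "\<And>k. good k \<Longrightarrow> k \<le> Greatest good"
    using GreatestI_nat[of good, OF good0 bound] Greatest_le_nat[of good, OF _ bound] by blast+
  define k where "k = Greatest good"
  from g[folded k_def] obtain P Q where PQ: "P \<in> carrier_mat d d" "Q \<in> carrier_mat d d" "P * Q = 1\<^sub>m d"
    and kd: "k \<le> d"
    and sub: "\<And>v. v \<in> carrier_vec d \<Longrightarrow> \<forall>j<d. k \<le> j \<longrightarrow> v $ j = 0 \<Longrightarrow> P *\<^sub>v v \<in> W"
    unfolding good_def by blast
  have QP: "Q * P = 1\<^sub>m d" by (rule mat_mult_left_right_inverse[OF PQ])
  have "v $ j = 0" if v: "v \<in> carrier_vec d" "P *\<^sub>v v \<in> W" "j < d" "k \<le> j" for v j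
  proof (rule ccontr)
    assume "v $ j \<noteq> 0"
    moreover have "Q *\<^sub>v (P *\<^sub>v v) = v"
      using PQ QP v(1) by (simp add: assoc_mult_mat_vec[symmetric, of _ d d _ d])
    ultimately have "(Q *\<^sub>v (P *\<^sub>v v)) $ j \<noteq> 0" by simp
    from exchange_column[OF PQ W(1,3,4) v(4,3) sub v(2) this] have "good (Suc k)"
      unfolding good_def using v(3,4) by (intro conjI) (linarith, assumption)
    from max[OF this] show False by (simp add: k_def)
  qed
  with sub have "P *\<^sub>v v \<in> W \<longleftrightarrow> (\<forall>j<d. k \<le> j \<longrightarrow> v $ j = 0)" if "v \<in> carrier_vec d" for v
    using that by metis
  with PQ QP kd show ?thesis by (rule that)
qed


lemma subspace_vecD:
  assumes "VectorSpace.subspace class_ring W (module_vec TYPE(complex) d)"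
  shows "W \<subseteq> carrier_vec d" "0\<^sub>v d \<in> W"
    "\<And>v w. v \<in> W \<Longrightarrow> w \<in> W \<Longrightarrow> v + w \<in> W" "\<And>c v. v \<in> W \<Longrightarrow> c \<cdot>\<^sub>v v \<in> W"
  using assms unfolding VectorSpace.subspace_def submodule_def
  by (auto simp: module_vec_simps)

lemma sum_lessThan_add:
  fixes f :: "nat \<Rightarrow> 'b :: comm_monoid_add"
  shows "sum f {..<k + e} = sum f {..<k} + (\<Sum>l<e. f (k + l))"
  by (induction e) (simp_all add: add.assoc)

context finite_group
begin

text \<open>The diagonal blocks of block triangular matrices multiply independently of the off-diagonal
  block: the blocks are the sub- and the quotient representation belonging to the span of the first
  \<open>k\<close> basis vectors.\<close>

lemma block_triangular_rep:
  assumes d: "d = k + e"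
    and M: "\<And>g. g \<in> carrier G \<Longrightarrow> M g \<in> carrier_mat d d" "M \<one> = 1\<^sub>m d"
      "\<And>g h. g \<in> carrier G \<Longrightarrow> h \<in> carrier G \<Longrightarrow> M (g \<otimes> h) = M g * M h"
    and zero: "\<And>g i j. g \<in> carrier G \<Longrightarrow> i < e \<Longrightarrow> j < k \<Longrightarrow> M g $$ (k + i, j) = 0"
  shows "complex_rep G k (\<lambda>g. mat k k (\<lambda>(i, j). M g $$ (i, j)))"
    and "complex_rep G e (\<lambda>g. mat e e (\<lambda>(i, j). M g $$ (k + i, k + j)))"
    and "g \<in> carrier G \<Longrightarrow> mat_trace (M g) =
      mat_trace (mat k k (\<lambda>(i, j). M g $$ (i, j))) +
      mat_trace (mat e e (\<lambda>(i, j). M g $$ (k + i, k + j)))"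
proof -
  have prod: "M (g \<otimes> h) $$ (i, j) = (\<Sum>l<k. M g $$ (i, l) * M h $$ (l, j)) +
      (\<Sum>l<e. M g $$ (i, k + l) * M h $$ (k + l, j))"
    if "g \<in> carrier G" "h \<in> carrier G" "i < d" "j < d" for g h i j
    using that M by (simp add: index_mult_mat_eq_sum[of _ d d _ d] d sum_lessThan_add del: index_mult_mat)
  have "mat k k (\<lambda>(i, j). M (g \<otimes> h) $$ (i, j)) =
      mat k k (\<lambda>(i, j). M g $$ (i, j)) * mat k k (\<lambda>(i, j). M h $$ (i, j))"
    if gh: "g \<in> carrier G" "h \<in> carrier G" for g h
  proof (rule eq_matI, goal_cases)
    case (1 i j)
    hence ij: "i < k" "j < k" by auto
    have "M (g \<otimes> h) $$ (i, j) = (\<Sum>l<k. M g $$ (i, l) * M h $$ (l, j))"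
      using prod[OF gh, of i j] ij zero[OF gh(2)] by (simp add: d)
    thus ?case using ij by (subst index_mult_mat_eq_sum[of _ k k _ k]) auto
  qed auto
  thus "complex_rep G k (\<lambda>g. mat k k (\<lambda>(i, j). M g $$ (i, j)))"
    unfolding complex_rep_iff using M(2) by (auto simp: d intro!: eq_matI)
  have "mat e e (\<lambda>(i, j). M (g \<otimes> h) $$ (k + i, k + j)) =
      mat e e (\<lambda>(i, j). M g $$ (k + i, k + j)) * mat e e (\<lambda>(i, j). M h $$ (k + i, k + j))"
    if gh: "g \<in> carrier G" "h \<in> carrier G" for g h
  proof (rule eq_matI, goal_cases)
    case (1 i j)
    hence ij: "i < e" "j < e" by auto
    have "M (g \<otimes> h) $$ (k + i, k + j) = (\<Sum>l<e. M g $$ (k + i, k + l) * M h $$ (k + l, k + j))"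
      using prod[OF gh, of "k + i" "k + j"] ij zero[OF gh(1)] by (simp add: d)
    thus ?case using ij by (subst index_mult_mat_eq_sum[of _ e e _ e]) auto
  qed auto
  thus "complex_rep G e (\<lambda>g. mat e e (\<lambda>(i, j). M g $$ (k + i, k + j)))"
    unfolding complex_rep_iff using M(2) by (auto simp: d intro!: eq_matI)
  show "mat_trace (M g) = mat_trace (mat k k (\<lambda>(i, j). M g $$ (i, j))) +
      mat_trace (mat e e (\<lambda>(i, j). M g $$ (k + i, k + j)))" if "g \<in> carrier G"
    using carrier_matD[OF M(1)[OF that]] by (simp add: mat_trace_def d sum_lessThan_add)
qed

text \<open>In a basis adapted to an invariant subspace the matrices become block triangular; the zero
  block expresses the invariance. Both blocks are smaller because the subspace is proper and
  nonzero.\<close>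

lemma reducible_rep_splits:
  assumes rep: "complex_rep G d \<rho>" and red: "\<not> irreducible_rep G d \<rho>" "0 < d"
  obtains k e \<sigma> \<tau> where "k < d" "e < d" "complex_rep G k \<sigma>" "complex_rep G e \<tau>"
    "\<And>g. g \<in> carrier G \<Longrightarrow> mat_trace (\<rho> g) = mat_trace (\<sigma> g) + mat_trace (\<tau> g)"
proof -
  note R = rep_carrier[OF rep]
  obtain W where W: "VectorSpace.subspace class_ring W (module_vec TYPE(complex) d)"
    and inv: "\<And>g v. g \<in> carrier G \<Longrightarrow> v \<in> W \<Longrightarrow> \<rho> g *\<^sub>v v \<in> W"
    and ne: "W \<noteq> {0\<^sub>v d}" "W \<noteq> carrier_vec d"
    using rep red unfolding irreducible_rep_def by blast
  obtain k P Q where PQ: "P \<in> carrier_mat d d" "Q \<in> carrier_mat d d" "P * Q = 1\<^sub>m d" "Q * P = 1\<^sub>m d"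
    and kd: "k \<le> d"
    and PW: "\<And>v. v \<in> carrier_vec d \<Longrightarrow> P *\<^sub>v v \<in> W \<longleftrightarrow> (\<forall>j<d. k \<le> j \<longrightarrow> v $ j = 0)"
    by (rule adapted_basis[of W d]; (assumption | rule subspace_vecD[OF W] | rule that)+)
  have PQv: "P *\<^sub>v (Q *\<^sub>v v) = v" if "v \<in> carrier_vec d" for v
    using assoc_mult_mat_vec[OF PQ(1,2) that] PQ(3) that by simp
  have WQ: "v \<in> W \<longleftrightarrow> (\<forall>j<d. k \<le> j \<longrightarrow> (Q *\<^sub>v v) $ j = 0)" if "v \<in> carrier_vec d" for v
    using PW[of "Q *\<^sub>v v"] PQv[OF that] mult_mat_vec_carrier[OF PQ(2) that] by simp
  have "k \<noteq> d"
  proof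
    assume "k = d"
    hence "carrier_vec d \<subseteq> W" by (intro subsetI) (simp add: WQ)
    thus False using ne(2) subspace_vecD(1)[OF W] by simp
  qed
  have "k \<noteq> 0"
  proof
    assume k0: "k = 0"
    have "v = 0\<^sub>v d" if "v \<in> W" for v
    proof -
      have v: "v \<in> carrier_vec d" using that subspace_vecD(1)[OF W] by auto
      have Qv: "Q *\<^sub>v v \<in> carrier_vec d" by (rule mult_mat_vec_carrier[OF PQ(2) v])
      have "Q *\<^sub>v v = 0\<^sub>v d"
      proof (rule eq_vecI)
        fix i assume "i < dim_vec (0\<^sub>v d :: complex vec)"
        thus "(Q *\<^sub>v v) $ i = 0\<^sub>v d $ i" using WQ[OF v] that k0 by simp
      qed (use PQ in auto)
      thus ?thesis using PQv[OF v] mat_mult_zero_vec[OF PQ(1)] by simp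
    qed
    thus False using ne(1) subspace_vecD(2)[OF W] by blast
  qed
  define e where "e = d - k"
  have d: "d = k + e" and e: "e < d" "k < d"
    using kd \<open>k \<noteq> d\<close> \<open>k \<noteq> 0\<close> by (auto simp: e_def)
  define M where "M g = Q * (\<rho> g * P)" for g
  have M: "M g \<in> carrier_mat d d" if "g \<in> carrier G" for g
    unfolding M_def by (rule mult_carrier_mat[OF PQ(2) mult_carrier_mat[OF R[OF that] PQ(1)]])
  have M1: "M \<one> = 1\<^sub>m d" using PQ by (simp add: M_def rep_one[OF rep])
  have PM: "P * M g = \<rho> g * P" if "g \<in> carrier G" for g
    using assoc_mult_mat[OF PQ(1,2) mult_carrier_mat[OF R[OF that] PQ(1)]] PQ(3) R[OF that] PQ(1)
    by (simp add: M_def)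
  have Mm: "M (g \<otimes> h) = M g * M h" if gh: "g \<in> carrier G" "h \<in> carrier G" for g h
  proof -
    have "M (g \<otimes> h) = Q * (\<rho> g * (\<rho> h * P))"
      unfolding M_def rep_mult[OF rep gh] by (subst assoc_mult_mat[OF R[OF gh(1)] R[OF gh(2)] PQ(1)]) simp
    also have "\<dots> = Q * (\<rho> g * P * M h)"
      by (simp add: PM[OF gh(2), symmetric] assoc_mult_mat[OF R[OF gh(1)] PQ(1) M[OF gh(2)]])
    also have "\<dots> = M g * M h"
      unfolding M_def[of g]
      by (rule assoc_mult_mat[OF PQ(2) mult_carrier_mat[OF R[OF gh(1)] PQ(1)] M[OF gh(2)], symmetric])
    finally show ?thesis .
  qed
  have zero: "M g $$ (k + i, j) = 0" if g: "g \<in> carrier G" and ij: "i < e" "j < k" for g i j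
  proof -
    let ?v = "unit_vec d j :: complex vec"
    have j: "j < d" and v: "?v \<in> carrier_vec d" using ij d by auto
    have "P *\<^sub>v ?v \<in> W" using PW[OF v] ij by (simp add: unit_vec_def)
    hence "\<rho> g *\<^sub>v (P *\<^sub>v ?v) \<in> W" by (rule inv[OF g])
    also have "\<rho> g *\<^sub>v (P *\<^sub>v ?v) = P *\<^sub>v (M g *\<^sub>v ?v)"
      using assoc_mult_mat_vec[OF R[OF g] PQ(1) v] assoc_mult_mat_vec[OF PQ(1) M[OF g] v] PM[OF g] by simp
    finally have "(M g *\<^sub>v ?v) $ (k + i) = 0"
      using PW[OF mult_mat_vec_carrier[OF M[OF g] v]] ij d by simp
    thus ?thesis using M[OF g] ij j d by simp
  qed
  have tr: "mat_trace (\<rho> g) = mat_trace (M g)" if g: "g \<in> carrier G" for g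
  proof -
    have "mat_trace (M g) = mat_trace (\<rho> g * P * Q)"
      unfolding M_def by (rule mat_trace_mult_comm[OF PQ(2) mult_carrier_mat[OF R[OF g] PQ(1)]])
    also have "\<rho> g * P * Q = \<rho> g" using assoc_mult_mat[OF R[OF g] PQ(1,2)] PQ(3) R[OF g] by simp
    finally show ?thesis ..
  qed
  show ?thesis
  proof (rule that[OF e(2,1)])
    show "complex_rep G k (\<lambda>g. mat k k (\<lambda>(i, j). M g $$ (i, j)))"
      by (rule block_triangular_rep(1)) (fact d M M1 Mm zero)+
    show "complex_rep G e (\<lambda>g. mat e e (\<lambda>(i, j). M g $$ (k + i, k + j)))"
      by (rule block_triangular_rep(2)) (fact d M M1 Mm zero)+
    show "mat_trace (\<rho> g) = mat_trace (mat k k (\<lambda>(i, j). M g $$ (i, j))) +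
        mat_trace (mat e e (\<lambda>(i, j). M g $$ (k + i, k + j)))" if g: "g \<in> carrier G" for g
      unfolding tr[OF g] by (rule block_triangular_rep(3)) (fact d M M1 Mm zero g)+
  qed
qed

text \<open>The irreducible constituents are those of a composition series, found by induction on the degree.\<close>

lemma character_sum_of_Irr:
  assumes "complex_rep G d \<rho>"
  shows "\<exists>cs. set cs \<subseteq> Irr G \<and> (\<forall>g\<in>carrier G. mat_trace (\<rho> g) = (\<Sum>\<chi>\<leftarrow>cs. \<chi> g))"
  using assms
proof (induction d arbitrary: \<rho> rule: less_induct)
  case (less d)
  consider "d = 0" | "irreducible_rep G d \<rho>" | "0 < d" "\<not> irreducible_rep G d \<rho>" by blast
  thus ?case
  proof cases
    case 1
    have "mat_trace (\<rho> g) = 0" if "g \<in> carrier G" for g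
      using rep_carrier[OF less.prems that] 1 by (simp add: mat_trace_def)
    thus ?thesis by (intro exI[of _ "[]"]) simp
  next
    case 2
    thus ?thesis by (intro exI[of _ "[\<lambda>g\<in>carrier G. mat_trace (\<rho> g)]"]) (auto simp: Irr_def)
  next
    case 3
    obtain k e \<sigma> \<tau> where s: "k < d" "e < d" "complex_rep G k \<sigma>" "complex_rep G e \<tau>"
      "\<And>g. g \<in> carrier G \<Longrightarrow> mat_trace (\<rho> g) = mat_trace (\<sigma> g) + mat_trace (\<tau> g)"
      using reducible_rep_splits[OF less.prems 3(2,1)] by metis
    obtain cs1 cs2 where "set cs1 \<subseteq> Irr G" "\<forall>g\<in>carrier G. mat_trace (\<sigma> g) = (\<Sum>\<chi>\<leftarrow>cs1. \<chi> g)"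
      "set cs2 \<subseteq> Irr G" "\<forall>g\<in>carrier G. mat_trace (\<tau> g) = (\<Sum>\<chi>\<leftarrow>cs2. \<chi> g)"
      using less.IH[OF s(1,3)] less.IH[OF s(2,4)] by blast
    thus ?thesis using s(5) by (intro exI[of _ "cs1 @ cs2"]) simp
  qed
qed

end

section \<open>The regular representation and completeness of the irreducible characters\<close>

lemma sum_list_count:
  fixes f :: "'b \<Rightarrow> complex"
  shows "(\<Sum>x\<leftarrow>xs. f x) = (\<Sum>x\<in>set xs. of_nat (count_list xs x) * f x)"
proof (induction xs)
  case (Cons a xs)
  have "(\<Sum>x\<in>set (a # xs). of_nat (count_list (a # xs) x) * f x) =
    (\<Sum>x\<in>set (a # xs). of_nat (count_list xs x) * f x + (if x = a then f x else 0))"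
    by (intro sum.cong refl) (auto simp: algebra_simps)
  also have "\<dots> = (\<Sum>x\<in>set (a # xs). of_nat (count_list xs x) * f x) + f a"
    by (simp add: sum.distrib)
  also have "(\<Sum>x\<in>set (a # xs). of_nat (count_list xs x) * f x) =
      (\<Sum>x\<in>set xs. of_nat (count_list xs x) * f x)"
    by (intro sum.mono_neutral_right) (auto simp: count_list_0_iff)
  finally show ?case using Cons by (simp add: add.commute)
qed simp

context finite_group
begin

text \<open>Left translation permutes the group elements; only the identity has fixed points, and it fixes
  every element.\<close>

lemma regular_rep:
  obtains N \<rho> where "complex_rep G N \<rho>"
    "\<And>g. g \<in> carrier G \<Longrightarrow> mat_trace (\<rho> g) = (if g = \<one> then of_nat (card (carrier G)) else 0)"
proof -
  define N where "N = card (carrier G)"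
  obtain e where e: "bij_betw e {..<N} (carrier G)"
    using ex_bij_betw_nat_finite[OF fin] by (auto simp: N_def atLeast0LessThan)
  have ec: "e i \<in> carrier G" if "i < N" for i using e that by (auto simp: bij_betw_def)
  have ei: "e i = e j \<longleftrightarrow> i = j" if "i < N" "j < N" for i j
    using e that by (auto simp: bij_betw_def inj_on_def)
  define \<rho> :: "'a \<Rightarrow> complex mat" where "\<rho> g = mat N N (\<lambda>(i, j). of_bool (e i = g \<otimes> e j))" for g
  have "\<rho> (g \<otimes> h) = \<rho> g * \<rho> h" if gh: "g \<in> carrier G" "h \<in> carrier G" for g h
  proof (rule eq_matI, goal_cases)
    case (1 i j)
    hence ij: "i < N" "j < N" by (auto simp: \<rho>_def)
    have "(\<rho> g * \<rho> h) $$ (i, j) = (\<Sum>l<N. of_bool (e i = g \<otimes> e l) * of_bool (e l = h \<otimes> e j))"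
      using ij by (subst index_mult_mat_eq_sum[of _ N N _ N]) (auto simp: \<rho>_def)
    also have "\<dots> = (\<Sum>x\<in>carrier G. of_bool (e i = g \<otimes> x) * of_bool (x = h \<otimes> e j))"
      by (rule sum.reindex_bij_betw[OF e])
    also have "\<dots> = (\<Sum>x\<in>carrier G. if x = h \<otimes> e j then of_bool (e i = g \<otimes> (h \<otimes> e j)) else 0)"
      by (intro sum.cong) auto
    also have "\<dots> = of_bool (e i = g \<otimes> (h \<otimes> e j))" using fin gh ec[OF ij(2)] by simp
    also have "\<dots> = \<rho> (g \<otimes> h) $$ (i, j)" using ij gh ec by (simp add: \<rho>_def m_assoc)
    finally show ?case ..
  qed (auto simp: \<rho>_def)
  moreover have "\<rho> \<one> = 1\<^sub>m N" by (intro eq_matI) (auto simp: \<rho>_def ec ei)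
  ultimately have "complex_rep G N \<rho>" by (auto simp: complex_rep_iff \<rho>_def)
  moreover have "mat_trace (\<rho> g) = (if g = \<one> then of_nat (card (carrier G)) else 0)"
    if g: "g \<in> carrier G" for g
  proof -
    have "e i = g \<otimes> e i \<longleftrightarrow> g = \<one>" if "i < N" for i
      using g ec[OF that] by (metis l_one right_cancel one_closed)
    thus ?thesis by (simp add: mat_trace_def \<rho>_def N_def)
  qed
  ultimately show ?thesis by (rule that)
qed

lemma Irr_one:
  assumes "\<chi> \<in> Irr G"
  shows "\<chi> \<one> \<noteq> 0"
proof -
  obtain d \<rho> where *: "irreducible_rep G d \<rho>" "\<chi> = (\<lambda>g\<in>carrier G. mat_trace (\<rho> g))"
    using assms by (auto simp: Irr_def)
  have "\<chi> \<one> = of_nat d"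
    unfolding *(2) using rep_one[OF irreducible_repD(1)[OF *(1)]] by (simp add: mat_trace_one)
  thus ?thesis using irreducible_repD(2)[OF *(1)] by simp
qed

text \<open>By orthogonality, an irreducible character occurs in the regular character as often as
  its degree says. Since degrees are nonzero, the constituents \<open>cs\<close> of the
  regular character exhaust \<open>Irr G\<close>; in particular \<open>Irr G\<close> is finite, so that the sum over it
  is a proper one.\<close>

theorem sum_Irr_degree:
  assumes "g \<in> carrier G"
  shows "(\<Sum>\<chi>\<in>Irr G. \<chi> \<one> * \<chi> g) = (if g = \<one> then of_nat (card (carrier G)) else 0)"
proof -
  let ?N = "of_nat (card (carrier G)) :: complex"
  have N: "?N \<noteq> 0" using fin one_closed by auto
  obtain d \<rho> where reg: "complex_rep G d \<rho>"
    "\<And>g. g \<in> carrier G \<Longrightarrow> mat_trace (\<rho> g) = (if g = \<one> then ?N else 0)"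
    using regular_rep by blast
  obtain cs where cs: "set cs \<subseteq> Irr G"
    "\<And>g. g \<in> carrier G \<Longrightarrow> (if g = \<one> then ?N else 0) = (\<Sum>\<chi>\<leftarrow>cs. \<chi> g)"
    using character_sum_of_Irr[OF reg(1)] reg(2) by auto
  have count: "of_nat (count_list cs \<chi>) = \<chi> \<one>" if \<chi>: "\<chi> \<in> Irr G" for \<chi>
  proof -
    have "?N * \<chi> \<one> = (\<Sum>g\<in>carrier G. if g = \<one> then ?N * \<chi> \<one> else 0)"
      using fin by simp
    also have "\<dots> = (\<Sum>g\<in>carrier G. (if g = \<one> then ?N else 0) * \<chi> (inv g))"
      by (intro sum.cong) auto
    also have "\<dots> = (\<Sum>g\<in>carrier G. (\<Sum>\<psi>\<in>set cs. of_nat (count_list cs \<psi>) * \<psi> g) * \<chi> (inv g))"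
      by (intro sum.cong refl) (simp only: cs(2) sum_list_count)
    also have "\<dots> = (\<Sum>\<psi>\<in>set cs. of_nat (count_list cs \<psi>) * (\<Sum>g\<in>carrier G. \<psi> g * \<chi> (inv g)))"
      unfolding sum_distrib_right sum_distrib_left by (subst sum.swap) (simp add: mult.assoc)
    also have "\<dots> = (\<Sum>\<psi>\<in>set cs. if \<psi> = \<chi> then of_nat (count_list cs \<psi>) * ?N else 0)"
      by (intro sum.cong refl) (use cs(1) \<chi> in \<open>auto simp: Irr_orthogonality\<close>)
    also have "\<dots> = of_nat (count_list cs \<chi>) * ?N"
      by (auto simp: count_list_0_iff)
    finally show ?thesis using N by simp
  qed
  have "\<chi> \<in> set cs" if "\<chi> \<in> Irr G" for \<chi>
    using count[OF that] Irr_one[OF that] by (metis count_list_0_iff of_nat_0)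
  hence Irr: "Irr G = set cs" using cs(1) by auto
  show ?thesis
    unfolding cs(2)[OF assms] sum_list_count Irr
    by (intro sum.cong refl) (simp add: count Irr)
qed

section \<open>Class sums and Frobenius' formula\<close>

lemma conjugacy_classes_iff:
  "K \<in> conjugacy_classes G \<longleftrightarrow> (\<exists>h\<in>carrier G. K = (\<lambda>g. g \<otimes> h \<otimes> inv g) ` carrier G)"
  unfolding conjugacy_classes_def orbits_def orbit_def by (auto simp: image_def)

lemma conjugacy_class_subset: "K \<in> conjugacy_classes G \<Longrightarrow> K \<subseteq> carrier G"
  by (auto simp: conjugacy_classes_iff)

lemma in_own_conjugacy_class:
  assumes "h \<in> carrier G"
  shows "h \<in> (\<lambda>g. g \<otimes> h \<otimes> inv g) ` carrier G"
  using assms by (auto intro!: image_eqI[of _ _ \<one>])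

lemma conj_conj:
  assumes "a \<in> carrier G" "b \<in> carrier G" "h \<in> carrier G"
  shows "a \<otimes> (b \<otimes> h \<otimes> inv b) \<otimes> inv a = (a \<otimes> b) \<otimes> h \<otimes> inv (a \<otimes> b)"
  using assms by (simp add: inv_mult_group m_assoc)

lemma conjugacy_class_eq:
  assumes "K \<in> conjugacy_classes G" "x \<in> K"
  shows "K = (\<lambda>g. g \<otimes> x \<otimes> inv g) ` carrier G"
proof -
  obtain h where h: "h \<in> carrier G" "K = (\<lambda>g. g \<otimes> h \<otimes> inv g) ` carrier G"
    using assms(1) by (auto simp: conjugacy_classes_iff)
  obtain b where b: "b \<in> carrier G" "x = b \<otimes> h \<otimes> inv b" using assms(2) h by auto
  have "(\<lambda>g. g \<otimes> x \<otimes> inv g) ` carrier G = (\<lambda>g. g \<otimes> h \<otimes> inv g) ` ((\<lambda>g. g \<otimes> b) ` carrier G)"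
    unfolding image_image b(2) using conj_conj[OF _ b(1) h(1)] by (intro image_cong) auto
  also have "(\<lambda>g. g \<otimes> b) ` carrier G = carrier G"
  proof (intro equalityI subsetI)
    fix x assume x: "x \<in> carrier G"
    show "x \<in> (\<lambda>g. g \<otimes> b) ` carrier G"
      by (rule image_eqI[of _ _ "x \<otimes> inv b"]) (use x b(1) in \<open>simp_all add: m_assoc\<close>)
  qed (use b(1) in auto)
  finally show ?thesis using h by simp
qed

lemma conjugacy_class_conj:
  assumes "K \<in> conjugacy_classes G" "x \<in> K" "g \<in> carrier G"
  shows "g \<otimes> x \<otimes> inv g \<in> K"
  using assms(3) by (subst conjugacy_class_eq[OF assms(1,2)]) auto

lemma Irr_conj:
  assumes "\<chi> \<in> Irr G" "x \<in> carrier G" "g \<in> carrier G"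
  shows "\<chi> (g \<otimes> x \<otimes> inv g) = \<chi> x"
proof -
  obtain d \<rho> where *: "irreducible_rep G d \<rho>" "\<chi> = (\<lambda>g\<in>carrier G. mat_trace (\<rho> g))"
    using assms by (auto simp: Irr_def)
  note rep = irreducible_repD(1)[OF *(1)]
  have "mat_trace (\<rho> (g \<otimes> x \<otimes> inv g)) = mat_trace (\<rho> (g \<otimes> x) * \<rho> (inv g))"
    using assms by (simp add: rep_mult[OF rep])
  also have "\<dots> = mat_trace (\<rho> (inv g) * \<rho> (g \<otimes> x))"
    using assms by (intro mat_trace_mult_comm[of _ d d] rep_carrier[OF rep]) auto
  also have "\<rho> (inv g) * \<rho> (g \<otimes> x) = \<rho> (inv g \<otimes> (g \<otimes> x))"
    using assms by (simp add: rep_mult[OF rep])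
  also have "inv g \<otimes> (g \<otimes> x) = x" using assms by (simp add: m_assoc[symmetric])
  finally show ?thesis using assms by (simp add: *(2))
qed

lemma class_value_eq:
  assumes "\<chi> \<in> Irr G" "K \<in> conjugacy_classes G" "x \<in> K"
  shows "class_value \<chi> K = \<chi> x"
proof -
  have "(SOME y. y \<in> K) \<in> K" using assms(3) by (rule someI)
  then obtain g where "g \<in> carrier G" "(SOME y. y \<in> K) = g \<otimes> x \<otimes> inv g"
    using conjugacy_class_eq[OF assms(2,3)] by auto
  thus ?thesis
    using Irr_conj[OF assms(1)] conjugacy_class_subset[OF assms(2)] assms(3)
    by (auto simp: class_value_def)
qed

text \<open>A class sum is invariant under conjugation, hence commutes with the representation.\<close>

lemma class_sum_scalar:
  assumes irr: "irreducible_rep G d \<rho>" and K: "K \<in> conjugacy_classes G"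
  defines "\<chi> \<equiv> \<lambda>g\<in>carrier G. mat_trace (\<rho> g)"
  shows "mat_sum d d \<rho> K = (of_nat (card K) * class_value \<chi> K / of_nat d) \<cdot>\<^sub>m 1\<^sub>m d"
proof -
  note rep = irreducible_repD(1)[OF irr]
  note R = rep_carrier[OF rep]
  have \<chi>: "\<chi> \<in> Irr G" using irr by (auto simp: \<chi>_def Irr_def)
  have KG: "x \<in> carrier G" if "x \<in> K" for x using that conjugacy_class_subset[OF K] by auto
  have "\<rho> g * mat_sum d d \<rho> K = mat_sum d d \<rho> K * \<rho> g" if g: "g \<in> carrier G" for g
  proof -
    have bij: "bij_betw (\<lambda>x. g \<otimes> x \<otimes> inv g) K K"
    proof (rule bij_betw_byWitness[where f' = "\<lambda>x. inv g \<otimes> x \<otimes> inv (inv g)"])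
      show "\<forall>x\<in>K. inv g \<otimes> (g \<otimes> x \<otimes> inv g) \<otimes> inv (inv g) = x"
        using conj_conj[OF inv_closed[OF g] g KG] g KG by simp
      show "\<forall>x\<in>K. g \<otimes> (inv g \<otimes> x \<otimes> inv (inv g)) \<otimes> inv g = x"
        using conj_conj[OF g inv_closed[OF g] KG] g KG by simp
    qed (use conjugacy_class_conj[OF K _ g] conjugacy_class_conj[OF K _ inv_closed[OF g]] g in auto)
    have "\<rho> g * mat_sum d d \<rho> K = mat_sum d d (\<lambda>x. \<rho> g * \<rho> x) K"
      by (rule mult_mat_sum[OF R[OF g] R[OF KG]])
    also have "\<dots> = mat_sum d d (\<lambda>x. \<rho> (g \<otimes> x \<otimes> inv g) * \<rho> g) K"
      by (rule mat_sum_cong) (simp add: rep_mult[OF rep, symmetric] g KG m_assoc)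
    also have "\<dots> = mat_sum d d (\<lambda>x. \<rho> x * \<rho> g) K"
      by (rule mat_sum_reindex[OF bij, where f = "\<lambda>x. \<rho> x * \<rho> g"])
    also have "\<dots> = mat_sum d d \<rho> K * \<rho> g"
      by (rule mat_sum_mult[OF R[OF g] R[OF KG], symmetric])
    finally show ?thesis .
  qed
  hence "mat_sum d d \<rho> K = (mat_trace (mat_sum d d \<rho> K) / of_nat d) \<cdot>\<^sub>m 1\<^sub>m d"
    by (intro schur_scalar[OF irr]) auto
  also have "mat_trace (mat_sum d d \<rho> K) = (\<Sum>x\<in>K. mat_trace (\<rho> x))"
    by (intro mat_trace_mat_sum R KG)
  also have "\<dots> = (\<Sum>x\<in>K. class_value \<chi> K)"
  proof (rule sum.cong[OF refl])
    fix x assume x: "x \<in> K"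
    show "mat_trace (\<rho> x) = class_value \<chi> K"
      unfolding class_value_eq[OF \<chi> K x] by (simp add: \<chi>_def KG[OF x])
  qed
  finally show ?thesis by simp
qed

text \<open>Both sides evaluate, up to the factor \<open>\<chi> \<one>\<close>, the trace of
  \<open>(\<Sum>x\<in>K. \<rho> x) (\<Sum>y\<in>L. \<rho> y) \<rho> z\<close>: once by expanding, once by replacing the
  class sums by scalars.\<close>

lemma class_product_character_sum:
  assumes \<chi>: "\<chi> \<in> Irr G" and K: "K \<in> conjugacy_classes G" and L: "L \<in> conjugacy_classes G"
    and z: "z \<in> carrier G"
  shows "(\<Sum>x\<in>K. \<Sum>y\<in>L. \<chi> (x \<otimes> y \<otimes> z)) * \<chi> \<one> =
    of_nat (card K) * of_nat (card L) * (class_value \<chi> K * class_value \<chi> L * \<chi> z / \<chi> \<one>)"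
proof -
  obtain d \<rho> where *: "irreducible_rep G d \<rho>" "\<chi> = (\<lambda>g\<in>carrier G. mat_trace (\<rho> g))"
    using \<chi> by (auto simp: Irr_def)
  note rep = irreducible_repD(1)[OF *(1)] and d = irreducible_repD(2)[OF *(1)]
  note R = rep_carrier[OF rep]
  note KG = subsetD[OF conjugacy_class_subset[OF K]] and LG = subsetD[OF conjugacy_class_subset[OF L]]
  have \<chi>1: "\<chi> \<one> = of_nat d" unfolding *(2) by (simp add: rep_one[OF rep] mat_trace_one)
  define a where "a = of_nat (card K) * class_value \<chi> K / of_nat d"
  define b where "b = of_nat (card L) * class_value \<chi> L / of_nat d"
  have Ka: "mat_sum d d \<rho> K = a \<cdot>\<^sub>m 1\<^sub>m d" and Lb: "mat_sum d d \<rho> L = b \<cdot>\<^sub>m 1\<^sub>m d"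
    unfolding a_def b_def *(2) by (rule class_sum_scalar[OF *(1)], fact)+
  have "mat_sum d d \<rho> L * \<rho> z = mat_sum d d (\<lambda>y. \<rho> (y \<otimes> z)) L"
    by (subst mat_sum_mult[OF R[OF z] R[OF LG]], assumption)
       (auto intro!: mat_sum_cong simp: rep_mult[OF rep] LG z)
  moreover have "mat_sum d d \<rho> L * \<rho> z = b \<cdot>\<^sub>m \<rho> z"
    unfolding Lb using R[OF z] by (simp add: mult_smult_assoc_mat[of _ d d _ d])
  ultimately have L1: "mat_sum d d (\<lambda>y. \<rho> (y \<otimes> z)) L = b \<cdot>\<^sub>m \<rho> z" by simp
  have "a * (b * \<chi> z) = mat_trace (a \<cdot>\<^sub>m (b \<cdot>\<^sub>m \<rho> z))"
    using R[OF z] z by (simp add: mat_trace_smult[of _ d] *(2))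
  also have "a \<cdot>\<^sub>m (b \<cdot>\<^sub>m \<rho> z) = mat_sum d d \<rho> K * (b \<cdot>\<^sub>m \<rho> z)"
    unfolding Ka using R[OF z] by (simp add: mult_smult_assoc_mat[of _ d d _ d])
  also have "\<dots> = mat_sum d d (\<lambda>x. \<rho> x * (b \<cdot>\<^sub>m \<rho> z)) K"
    using R[OF z] by (intro mat_sum_mult R KG) auto
  also have "\<dots> = mat_sum d d (\<lambda>x. mat_sum d d (\<lambda>y. \<rho> (x \<otimes> y \<otimes> z)) L) K"
  proof (rule mat_sum_cong)
    fix x assume x: "x \<in> K"
    have "\<rho> x * (b \<cdot>\<^sub>m \<rho> z) = mat_sum d d (\<lambda>y. \<rho> x * \<rho> (y \<otimes> z)) L"
      unfolding L1[symmetric] using z by (intro mult_mat_sum R[OF KG[OF x]] R) (simp add: LG)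
    also have "\<dots> = mat_sum d d (\<lambda>y. \<rho> (x \<otimes> y \<otimes> z)) L"
      using KG[OF x] z LG by (intro mat_sum_cong) (simp add: m_assoc rep_mult[OF rep])
    finally show "\<rho> x * (b \<cdot>\<^sub>m \<rho> z) = mat_sum d d (\<lambda>y. \<rho> (x \<otimes> y \<otimes> z)) L" .
  qed
  also have "mat_trace \<dots> = (\<Sum>x\<in>K. mat_trace (mat_sum d d (\<lambda>y. \<rho> (x \<otimes> y \<otimes> z)) L))"
    by (intro mat_trace_mat_sum) simp
  also have "\<dots> = (\<Sum>x\<in>K. \<Sum>y\<in>L. mat_trace (\<rho> (x \<otimes> y \<otimes> z)))"
    using KG LG z by (intro sum.cong refl mat_trace_mat_sum R) simp
  also have "\<dots> = (\<Sum>x\<in>K. \<Sum>y\<in>L. \<chi> (x \<otimes> y \<otimes> z))"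
    using KG LG z by (intro sum.cong refl) (simp add: *(2))
  finally show ?thesis using d by (simp add: \<chi>1 a_def b_def field_simps)
qed

text \<open>Summing \<open>class_product_character_sum\<close> over all \<open>\<chi>\<close> makes the regular character appear on the left,
  which detects the solutions of \<open>x \<otimes> y \<otimes> z = \<one>\<close>. The target is \<open>inv z\<close> so that \<open>\<chi> z\<close>
  occurs in place of its complex conjugate.\<close>

theorem frobenius_class_product:
  assumes K: "K \<in> conjugacy_classes G" and L: "L \<in> conjugacy_classes G" and z: "z \<in> carrier G"
  shows "of_nat (card {(x, y). x \<in> K \<and> y \<in> L \<and> x \<otimes> y = inv z}) =
    of_nat (card K) * of_nat (card L) / of_nat (card (carrier G)) *
    (\<Sum>\<chi>\<in>Irr G. class_value \<chi> K * class_value \<chi> L * \<chi> z / \<chi> \<one>)"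
proof -
  let ?N = "of_nat (card (carrier G)) :: complex"
  note KG = subsetD[OF conjugacy_class_subset[OF K]] and LG = subsetD[OF conjugacy_class_subset[OF L]]
  have finK: "finite K" "finite L"
    using finite_subset[OF conjugacy_class_subset fin] K L by auto
  have N: "?N \<noteq> 0" using fin one_closed by auto
  have "of_nat (card K) * of_nat (card L) *
      (\<Sum>\<chi>\<in>Irr G. class_value \<chi> K * class_value \<chi> L * \<chi> z / \<chi> \<one>) =
    (\<Sum>\<chi>\<in>Irr G. \<Sum>x\<in>K. \<Sum>y\<in>L. \<chi> \<one> * \<chi> (x \<otimes> y \<otimes> z))"
    unfolding sum_distrib_left
  proof (rule sum.cong[OF refl])
    fix \<chi> assume "\<chi> \<in> Irr G"
    from class_product_character_sum[OF this K L z]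
    show "of_nat (card K) * of_nat (card L) * (class_value \<chi> K * class_value \<chi> L * \<chi> z / \<chi> \<one>) =
        (\<Sum>x\<in>K. \<Sum>y\<in>L. \<chi> \<one> * \<chi> (x \<otimes> y \<otimes> z))"
      by (simp add: mult.commute flip: sum_distrib_left)
  qed
  also have "\<dots> = (\<Sum>x\<in>K. \<Sum>y\<in>L. \<Sum>\<chi>\<in>Irr G. \<chi> \<one> * \<chi> (x \<otimes> y \<otimes> z))"
    by (subst sum.swap, subst (2) sum.swap) simp
  also have "\<dots> = (\<Sum>x\<in>K. \<Sum>y\<in>L. if x \<otimes> y = inv z then ?N else 0)"
  proof (intro sum.cong refl)
    fix x y assume "x \<in> K" "y \<in> L"
    hence xy: "x \<otimes> y \<in> carrier G" using KG LG by simp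
    hence "x \<otimes> y \<otimes> z = \<one> \<longleftrightarrow> x \<otimes> y = inv z"
      using z by (metis inv_equality inv_inv l_inv)
    thus "(\<Sum>\<chi>\<in>Irr G. \<chi> \<one> * \<chi> (x \<otimes> y \<otimes> z)) = (if x \<otimes> y = inv z then ?N else 0)"
      using sum_Irr_degree[of "x \<otimes> y \<otimes> z"] xy z by simp
  qed
  also have "\<dots> = (\<Sum>p\<in>K \<times> L. if (case p of (x, y) \<Rightarrow> x \<otimes> y = inv z) then ?N else 0)"
    by (simp add: sum.cartesian_product case_prod_beta)
  also have "\<dots> = ?N * of_nat (card {p \<in> K \<times> L. case p of (x, y) \<Rightarrow> x \<otimes> y = inv z})"
    using finK by (subst sum.inter_filter[symmetric]) auto
  also have "{p \<in> K \<times> L. case p of (x, y) \<Rightarrow> x \<otimes> y = inv z} =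
      {(x, y). x \<in> K \<and> y \<in> L \<and> x \<otimes> y = inv z}" by auto
  finally show ?thesis using N by (simp add: field_simps)
qed

end

section \<open>Products of permutations of small support\<close>

definition small_moved :: "nat \<Rightarrow> nat \<Rightarrow> (nat \<Rightarrow> nat) set" where
  "small_moved n r = {\<sigma> \<in> carrier (symm n). card (moved n \<sigma>) \<le> r}"

definition small_factorizations ::
  "nat \<Rightarrow> nat \<Rightarrow> (nat \<Rightarrow> nat) \<Rightarrow> ((nat \<Rightarrow> nat) \<times> (nat \<Rightarrow> nat)) set" where
  "small_factorizations n r z =
     {(x, y). x \<in> small_moved n r \<and> y \<in> small_moved n r \<and> x \<otimes>\<^bsub>symm n\<^esub> y = z}"

lemma carrier_symm: "carrier (symm n) = {p. p permutes {1..n}}"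
  and mult_symm: "x \<otimes>\<^bsub>symm n\<^esub> y = y \<circ> x"
  and one_symm: "\<one>\<^bsub>symm n\<^esub> = id"
  by (simp_all add: symm_def sym_group_def)

lemma finite_group_symm: "finite_group (symm n)"
proof -
  have "group (symm n)"
  proof (rule groupI)
    fix x assume "x \<in> carrier (symm n)"
    thus "\<exists>y\<in>carrier (symm n). y \<otimes>\<^bsub>symm n\<^esub> x = \<one>\<^bsub>symm n\<^esub>"
      by (intro bexI[of _ "inv' x"])
         (auto simp: carrier_symm mult_symm one_symm permutes_inv permutes_inv_o)
  qed (auto simp: carrier_symm mult_symm one_symm permutes_compose permutes_id comp_assoc)
  thus ?thesis
    by (auto simp: finite_group_def finite_group_axioms_def carrier_symm finite_permutations)
qed

lemma card_symm: "card (carrier (symm n)) = fact n"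
  by (simp add: carrier_symm card_permutations)

context
  fixes n :: nat
begin

interpretation finite_group "symm n" by (rule finite_group_symm)

lemma finite_moved: "finite (moved n \<sigma>)"
  by (simp add: moved_def)

lemma symm_inv_apply:
  assumes "x \<in> carrier (symm n)"
  shows "x ((inv\<^bsub>symm n\<^esub> x) i) = i" "(inv\<^bsub>symm n\<^esub> x) (x i) = i"
  using l_inv[OF assms] r_inv[OF assms] by (auto simp: mult_symm one_symm fun_eq_iff)

lemma symm_image: "x \<in> carrier (symm n) \<Longrightarrow> x i \<in> {1..n} \<longleftrightarrow> i \<in> {1..n}"
  unfolding carrier_symm using permutes_in_image by fastforce

lemma moved_inv:
  assumes "x \<in> carrier (symm n)"
  shows "moved n (inv\<^bsub>symm n\<^esub> x) = moved n x"
  using symm_inv_apply[OF assms] by (auto simp: moved_def) metis+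

lemma moved_mult_subset:
  "x \<in> carrier (symm n) \<Longrightarrow> moved n (x \<otimes>\<^bsub>symm n\<^esub> y) \<subseteq> moved n x \<union> moved n y"
  by (auto simp: moved_def mult_symm)

lemma card_moved_conj:
  assumes "x \<in> carrier (symm n)" "g \<in> carrier (symm n)"
  shows "card (moved n (g \<otimes>\<^bsub>symm n\<^esub> x \<otimes>\<^bsub>symm n\<^esub> inv\<^bsub>symm n\<^esub> g)) = card (moved n x)"
proof (rule bij_betw_same_card[OF bij_betw_byWitness[where f = g and f' = "inv\<^bsub>symm n\<^esub> g"]])
  show "g ` moved n (g \<otimes>\<^bsub>symm n\<^esub> x \<otimes>\<^bsub>symm n\<^esub> inv\<^bsub>symm n\<^esub> g) \<subseteq> moved n x"
    using symm_image[OF assms(2)] symm_inv_apply[OF assms(2)]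
    by (auto simp: moved_def mult_symm)
  show "(inv\<^bsub>symm n\<^esub> g) ` moved n x \<subseteq> moved n (g \<otimes>\<^bsub>symm n\<^esub> x \<otimes>\<^bsub>symm n\<^esub> inv\<^bsub>symm n\<^esub> g)"
  proof (rule image_subsetI)
    fix i assume i: "i \<in> moved n x"
    have "(inv\<^bsub>symm n\<^esub> g) (x i) \<noteq> (inv\<^bsub>symm n\<^esub> g) i"
      using i symm_inv_apply(1)[OF assms(2)] by (metis (mono_tags, lifting) mem_Collect_eq moved_def)
    thus "(inv\<^bsub>symm n\<^esub> g) i \<in> moved n (g \<otimes>\<^bsub>symm n\<^esub> x \<otimes>\<^bsub>symm n\<^esub> inv\<^bsub>symm n\<^esub> g)"
      using i symm_image[OF inv_closed[OF assms(2)], of i] symm_inv_apply[OF assms(2)]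
      by (simp add: moved_def mult_symm)
  qed
qed (use symm_inv_apply[OF assms(2)] in auto)

lemma card_moved_ge_2:
  assumes z: "z \<in> carrier (symm n)" "z \<noteq> \<one>\<^bsub>symm n\<^esub>"
  shows "2 \<le> card (moved n z)"
proof -
  obtain i where i: "z i \<noteq> i" using z(2) by (auto simp: one_symm fun_eq_iff)
  have iI: "i \<in> {1..n}" using i z(1) by (auto simp: carrier_symm permutes_def)
  have "z (z i) \<noteq> z i" using i symm_inv_apply(2)[OF z(1)] by metis
  hence "{i, z i} \<subseteq> moved n z" using i iI symm_image[OF z(1)] by (auto simp: moved_def)
  from card_mono[OF finite_moved this] i show ?thesis by simp
qed

lemma card_moved_one: "card (moved n \<one>\<^bsub>symm n\<^esub>) = 0"
  by (simp add: moved_def one_symm)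

text \<open>A point \<open>\<sigma>\<close> of both balls splits the quotient of their centres as
  \<open>\<pi>\<tau>\<^sup>-\<^sup>1 = (\<pi>\<sigma>\<^sup>-\<^sup>1)(\<sigma>\<tau>\<^sup>-\<^sup>1)\<close>, and the second factor recovers \<open>\<sigma>\<close>.\<close>

lemma card_ball_intersection:
  assumes "\<pi> \<in> carrier (symm n)" "\<tau> \<in> carrier (symm n)"
  shows "card (hamming_ball n r \<pi> \<inter> hamming_ball n r \<tau>) =
    card (small_factorizations n r (\<pi> \<otimes>\<^bsub>symm n\<^esub> inv\<^bsub>symm n\<^esub> \<tau>))"
proof (rule bij_betw_same_card[OF bij_betw_byWitness[
      where f = "\<lambda>\<sigma>. (\<pi> \<otimes>\<^bsub>symm n\<^esub> inv\<^bsub>symm n\<^esub> \<sigma>, \<sigma> \<otimes>\<^bsub>symm n\<^esub> inv\<^bsub>symm n\<^esub> \<tau>)"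
        and f' = "\<lambda>(x, y). y \<otimes>\<^bsub>symm n\<^esub> \<tau>"]])
  have sym: "hamming n \<tau> \<sigma> = card (moved n (\<sigma> \<otimes>\<^bsub>symm n\<^esub> inv\<^bsub>symm n\<^esub> \<tau>))"
    if "\<sigma> \<in> carrier (symm n)" for \<sigma>
    using moved_inv[of "\<sigma> \<otimes>\<^bsub>symm n\<^esub> inv\<^bsub>symm n\<^esub> \<tau>"] that assms by (simp add: hamming_def inv_mult_group)
  have cancel: "inv\<^bsub>symm n\<^esub> a \<otimes>\<^bsub>symm n\<^esub> (a \<otimes>\<^bsub>symm n\<^esub> b) = b"
    if "a \<in> carrier (symm n)" "b \<in> carrier (symm n)" for a b
    using that by (simp add: m_assoc[symmetric])
  let ?f = "\<lambda>\<sigma>. (\<pi> \<otimes>\<^bsub>symm n\<^esub> inv\<^bsub>symm n\<^esub> \<sigma>, \<sigma> \<otimes>\<^bsub>symm n\<^esub> inv\<^bsub>symm n\<^esub> \<tau>)"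
  let ?F = "small_factorizations n r (\<pi> \<otimes>\<^bsub>symm n\<^esub> inv\<^bsub>symm n\<^esub> \<tau>)"
  show "?f ` (hamming_ball n r \<pi> \<inter> hamming_ball n r \<tau>) \<subseteq> ?F"
  proof (rule image_subsetI)
    fix \<sigma> assume "\<sigma> \<in> hamming_ball n r \<pi> \<inter> hamming_ball n r \<tau>"
    hence \<sigma>: "\<sigma> \<in> carrier (symm n)" "hamming n \<pi> \<sigma> \<le> r" "hamming n \<tau> \<sigma> \<le> r"
      by (auto simp: hamming_ball_def)
    have "(\<pi> \<otimes>\<^bsub>symm n\<^esub> inv\<^bsub>symm n\<^esub> \<sigma>) \<otimes>\<^bsub>symm n\<^esub> (\<sigma> \<otimes>\<^bsub>symm n\<^esub> inv\<^bsub>symm n\<^esub> \<tau>) =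
        \<pi> \<otimes>\<^bsub>symm n\<^esub> inv\<^bsub>symm n\<^esub> \<tau>"
      using \<sigma>(1) assms cancel[of \<sigma> "inv\<^bsub>symm n\<^esub> \<tau>"] by (simp add: m_assoc)
    thus "?f \<sigma> \<in> ?F"
      using \<sigma>(2) \<sigma>(3)[unfolded sym[OF \<sigma>(1)]] \<sigma>(1) assms
      by (simp add: small_factorizations_def small_moved_def hamming_def)
  qed
  have recovered: "?f (y \<otimes>\<^bsub>symm n\<^esub> \<tau>) = (x, y)"
    if "x \<in> carrier (symm n)" "y \<in> carrier (symm n)"
      "x \<otimes>\<^bsub>symm n\<^esub> y = \<pi> \<otimes>\<^bsub>symm n\<^esub> inv\<^bsub>symm n\<^esub> \<tau>" for x y
  proof -
    have "\<pi> \<otimes>\<^bsub>symm n\<^esub> inv\<^bsub>symm n\<^esub> (y \<otimes>\<^bsub>symm n\<^esub> \<tau>) =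
        (\<pi> \<otimes>\<^bsub>symm n\<^esub> inv\<^bsub>symm n\<^esub> \<tau>) \<otimes>\<^bsub>symm n\<^esub> inv\<^bsub>symm n\<^esub> y"
      using that(1,2) assms by (simp add: inv_mult_group m_assoc)
    also have "\<dots> = x \<otimes>\<^bsub>symm n\<^esub> y \<otimes>\<^bsub>symm n\<^esub> inv\<^bsub>symm n\<^esub> y" by (simp only: that(3))
    also have "\<dots> = x" using that(1,2) by (simp add: m_assoc)
    finally show ?thesis using that(2) assms by (simp add: m_assoc)
  qed
  show "\<forall>\<sigma>\<in>hamming_ball n r \<pi> \<inter> hamming_ball n r \<tau>. (case ?f \<sigma> of (x, y) \<Rightarrow> y \<otimes>\<^bsub>symm n\<^esub> \<tau>) = \<sigma>"
    using assms by (auto simp: hamming_ball_def m_assoc)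
  show "\<forall>p\<in>?F. ?f (case p of (x, y) \<Rightarrow> y \<otimes>\<^bsub>symm n\<^esub> \<tau>) = p"
    using recovered by (auto simp: small_factorizations_def small_moved_def)
  show "(\<lambda>(x, y). y \<otimes>\<^bsub>symm n\<^esub> \<tau>) ` ?F \<subseteq> hamming_ball n r \<pi> \<inter> hamming_ball n r \<tau>"
  proof (rule image_subsetI, clarify)
    fix x y assume "(x, y) \<in> ?F"
    hence xy: "x \<in> carrier (symm n)" "y \<in> carrier (symm n)"
      "x \<otimes>\<^bsub>symm n\<^esub> y = \<pi> \<otimes>\<^bsub>symm n\<^esub> inv\<^bsub>symm n\<^esub> \<tau>"
      and le: "card (moved n x) \<le> r" "card (moved n y) \<le> r"
      by (auto simp: small_factorizations_def small_moved_def)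
    have y\<tau>: "y \<otimes>\<^bsub>symm n\<^esub> \<tau> \<in> carrier (symm n)" using xy assms by simp
    have "hamming n \<pi> (y \<otimes>\<^bsub>symm n\<^esub> \<tau>) = card (moved n x)"
      "hamming n \<tau> (y \<otimes>\<^bsub>symm n\<^esub> \<tau>) = card (moved n y)"
      using recovered[OF xy] unfolding sym[OF y\<tau>] by (simp_all add: hamming_def)
    thus "y \<otimes>\<^bsub>symm n\<^esub> \<tau> \<in> hamming_ball n r \<pi> \<inter> hamming_ball n r \<tau>"
      using y\<tau> le by (simp add: hamming_ball_def)
  qed
qed

text \<open>Inverting and swapping the two factors preserves the sizes of their supports. This makes up for
  the inverse in \<open>frobenius_class_product\<close>.\<close>

lemma card_small_factorizations_inv:
  assumes "z \<in> carrier (symm n)"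
  shows "card (small_factorizations n r (inv\<^bsub>symm n\<^esub> z)) = card (small_factorizations n r z)"
proof -
  let ?h = "\<lambda>(x, y). (inv\<^bsub>symm n\<^esub> y, inv\<^bsub>symm n\<^esub> x)"
  have sub: "?h ` small_factorizations n r w \<subseteq> small_factorizations n r (inv\<^bsub>symm n\<^esub> w)" for w
  proof (rule image_subsetI, clarify)
    fix x y assume "(x, y) \<in> small_factorizations n r w"
    thus "(inv\<^bsub>symm n\<^esub> y, inv\<^bsub>symm n\<^esub> x) \<in> small_factorizations n r (inv\<^bsub>symm n\<^esub> w)"
      using inv_mult_group[of x y] by (auto simp: small_factorizations_def small_moved_def moved_inv)
  qed
  have inj: "\<forall>p\<in>small_factorizations n r w. ?h (?h p) = p" for w
    by (auto simp: small_factorizations_def small_moved_def)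
  have "bij_betw ?h (small_factorizations n r (inv\<^bsub>symm n\<^esub> z)) (small_factorizations n r z)"
  proof (rule bij_betw_byWitness[where f' = ?h])
    show "?h ` small_factorizations n r (inv\<^bsub>symm n\<^esub> z) \<subseteq> small_factorizations n r z"
      using sub[of "inv\<^bsub>symm n\<^esub> z"] by (simp only: inv_inv[OF assms])
  qed (rule inj inj sub)+
  thus ?thesis by (rule bij_betw_same_card)
qed

lemma small_factorizations_empty:
  assumes "2 * r < card (moved n z)"
  shows "small_factorizations n r z = {}"
proof -
  have False if "(x, y) \<in> small_factorizations n r z" for x y
  proof -
    have xy: "x \<in> carrier (symm n)" "card (moved n x) \<le> r" "card (moved n y) \<le> r"
      "x \<otimes>\<^bsub>symm n\<^esub> y = z"
      using that by (auto simp: small_factorizations_def small_moved_def)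
    have "card (moved n z) \<le> card (moved n x \<union> moved n y)"
      using moved_mult_subset[OF xy(1), of y] xy(4) finite_moved by (intro card_mono) auto
    also have "\<dots> \<le> card (moved n x) + card (moved n y)" by (rule card_Un_le)
    finally show False using assms xy by simp
  qed
  thus ?thesis by auto
qed

text \<open>Distinct permutations have distance at least \<open>2\<close>, because a permutation cannot move exactly
  one point. So the condition on the centres says that their quotient is not the identity.\<close>

lemma max_ball_intersection_eq:
  "max_ball_intersection n r =
    Max ((\<lambda>z. card (small_factorizations n r z)) ` (carrier (symm n) - {\<one>\<^bsub>symm n\<^esub>}))"
proof -
  have "{card (hamming_ball n r \<pi> \<inter> hamming_ball n r \<tau>) | \<pi> \<tau>.
      \<pi> \<in> carrier (symm n) \<and> \<tau> \<in> carrier (symm n) \<and> 2 \<le> hamming n \<pi> \<tau>} =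
    (\<lambda>z. card (small_factorizations n r z)) ` (carrier (symm n) - {\<one>\<^bsub>symm n\<^esub>})" (is "?A = ?B")
  proof (intro equalityI subsetI)
    fix c assume "c \<in> ?A"
    then obtain \<pi> \<tau> where *: "c = card (hamming_ball n r \<pi> \<inter> hamming_ball n r \<tau>)"
      "\<pi> \<in> carrier (symm n)" "\<tau> \<in> carrier (symm n)" "2 \<le> hamming n \<pi> \<tau>" by auto
    have "\<pi> \<otimes>\<^bsub>symm n\<^esub> inv\<^bsub>symm n\<^esub> \<tau> \<noteq> \<one>\<^bsub>symm n\<^esub>"
      using *(4) card_moved_one by (auto simp: hamming_def)
    thus "c \<in> ?B" using * card_ball_intersection[OF *(2,3)] by auto
  next
    fix c assume "c \<in> ?B"
    then obtain z where z: "z \<in> carrier (symm n)" "z \<noteq> \<one>\<^bsub>symm n\<^esub>"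
      "c = card (small_factorizations n r z)" by auto
    have "c = card (hamming_ball n r z \<inter> hamming_ball n r \<one>\<^bsub>symm n\<^esub>)"
      using card_ball_intersection[OF z(1) one_closed] z by simp
    moreover have "2 \<le> hamming n z \<one>\<^bsub>symm n\<^esub>"
      using card_moved_ge_2[OF z(1,2)] z(1) by (simp add: hamming_def)
    ultimately show "c \<in> ?A" using z(1) one_closed by blast
  qed
  thus ?thesis by (simp add: max_ball_intersection_def)
qed

lemma ex_class_index:
  assumes C: "bij_betw C {1..m} (conjugacy_classes (symm n))" and z: "z \<in> carrier (symm n)"
  shows "\<exists>s\<in>{1..m}. z \<in> C s"
proof -
  let ?K = "(\<lambda>g. g \<otimes>\<^bsub>symm n\<^esub> z \<otimes>\<^bsub>symm n\<^esub> inv\<^bsub>symm n\<^esub> g) ` carrier (symm n)"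
  have "?K \<in> conjugacy_classes (symm n)" using z unfolding conjugacy_classes_iff by blast
  hence "?K \<in> C ` {1..m}" using bij_betw_imp_surj_on[OF C] by simp
  then obtain s where "s \<in> {1..m}" "?K = C s" by (rule imageE)
  thus ?thesis using in_own_conjugacy_class[OF z] by blast
qed

text \<open>The permutations with small support form a union of conjugacy classes, so the factorizations are
  counted by summing Frobenius' formula over pairs of classes.\<close>

lemma frobenius_class_indices:
  assumes C: "bij_betw C {1..m} (conjugacy_classes (symm n))" and C1: "\<one>\<^bsub>symm n\<^esub> \<in> C 1"
    and m: "1 \<le> m" and s: "s \<in> {1..m}" "z \<in> C s"
  defines "\<Delta> \<equiv> class_indices n m C"
  shows "(\<Sum>i\<in>\<Delta> r. \<Sum>j\<in>\<Delta> r.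
      of_nat (card (C i)) * of_nat (card (C j)) / fact n *
      (\<Sum>\<chi>\<in>Irr (symm n).
         class_value \<chi> (C i) * class_value \<chi> (C j) * class_value \<chi> (C s)
           / class_value \<chi> (C 1))) = of_nat (card (small_factorizations n r z))"
proof -
  have cls: "C i \<in> conjugacy_classes (symm n)" if "i \<in> {1..m}" for i
    by (rule bij_betwE[OF C, rule_format, OF that])
  have \<Delta>: "i \<in> {1..m}" if "i \<in> \<Delta> r" for i using that by (auto simp: \<Delta>_def class_indices_def)
  have fin\<Delta>: "finite (\<Delta> r)" by (simp add: \<Delta>_def class_indices_def)
  have cls_carrier: "x \<in> carrier (symm n)" if "i \<in> {1..m}" "x \<in> C i" for i x
    using conjugacy_class_subset[OF cls[OF that(1)]] that(2) by blast
  have z: "z \<in> carrier (symm n)" by (rule cls_carrier[OF s])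
  have small: "x \<in> small_moved n r \<longleftrightarrow> (\<exists>i\<in>\<Delta> r. x \<in> C i)" for x
  proof
    assume x: "x \<in> small_moved n r"
    hence xc: "x \<in> carrier (symm n)" "card (moved n x) \<le> r" by (auto simp: small_moved_def)
    obtain i where i: "i \<in> {1..m}" "x \<in> C i"
      using ex_class_index[OF C xc(1)] by blast
    have "card (moved n y) \<le> r" if y: "y \<in> C i" for y
    proof -
      obtain g where "g \<in> carrier (symm n)" "y = g \<otimes>\<^bsub>symm n\<^esub> x \<otimes>\<^bsub>symm n\<^esub> inv\<^bsub>symm n\<^esub> g"
        using y by (subst (asm) conjugacy_class_eq[OF cls[OF i(1)] i(2)]) blast
      thus ?thesis using card_moved_conj[OF xc(1)] xc(2) by simp
    qed
    thus "\<exists>i\<in>\<Delta> r. x \<in> C i" using i by (auto simp: \<Delta>_def class_indices_def)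
  next
    assume "\<exists>i\<in>\<Delta> r. x \<in> C i"
    then obtain i where i: "i \<in> \<Delta> r" "x \<in> C i" by blast
    have "x \<in> carrier (symm n)" by (rule cls_carrier[OF \<Delta>[OF i(1)] i(2)])
    thus "x \<in> small_moved n r" using i by (auto simp: \<Delta>_def class_indices_def small_moved_def)
  qed
  have disj: "i = j" if "i \<in> {1..m}" "j \<in> {1..m}" "x \<in> C i" "x \<in> C j" for i j x
  proof -
    have "C i = C j"
      by (rule trans[OF conjugacy_class_eq[OF cls[OF that(1)] that(3)]
            conjugacy_class_eq[OF cls[OF that(2)] that(4), symmetric]])
    thus ?thesis using inj_onD[OF bij_betw_imp_inj_on[OF C]] that(1,2) by blast
  qed
  let ?F = "\<lambda>(i, j). {(x, y). x \<in> C i \<and> y \<in> C j \<and> x \<otimes>\<^bsub>symm n\<^esub> y = inv\<^bsub>symm n\<^esub> z}"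
  have split: "small_factorizations n r (inv\<^bsub>symm n\<^esub> z) = (\<Union>p\<in>\<Delta> r \<times> \<Delta> r. ?F p)"
    unfolding small_factorizations_def small by blast
  have "card (small_factorizations n r (inv\<^bsub>symm n\<^esub> z)) = (\<Sum>p\<in>\<Delta> r \<times> \<Delta> r. card (?F p))"
    unfolding split
  proof (rule card_UN_disjoint)
    show "\<forall>p\<in>\<Delta> r \<times> \<Delta> r. finite (?F p)"
    proof
      fix p assume p: "p \<in> \<Delta> r \<times> \<Delta> r"
      have "?F p \<subseteq> carrier (symm n) \<times> carrier (symm n)"
        using cls_carrier[OF \<Delta>, of "fst p"] cls_carrier[OF \<Delta>, of "snd p"] p
        by (cases p) (simp only: mem_Sigma_iff fst_conv snd_conv case_prod_conv, blast)
      thus "finite (?F p)" by (rule finite_subset) (simp add: fin)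
    qed
    show "\<forall>p\<in>\<Delta> r \<times> \<Delta> r. \<forall>q\<in>\<Delta> r \<times> \<Delta> r. p \<noteq> q \<longrightarrow> ?F p \<inter> ?F q = {}"
    proof (intro ballI impI)
      fix p q assume p: "p \<in> \<Delta> r \<times> \<Delta> r" and q: "q \<in> \<Delta> r \<times> \<Delta> r" and ne: "p \<noteq> q"
      obtain i j where p': "p = (i, j)" by (rule prod.exhaust)
      obtain i' j' where q': "q = (i', j')" by (rule prod.exhaust)
      note pq = p' q'
      have "i \<in> \<Delta> r" "j \<in> \<Delta> r" "i' \<in> \<Delta> r" "j' \<in> \<Delta> r"
        using p q unfolding pq mem_Sigma_iff by blast+
      note idx = this[THEN \<Delta>]
      show "?F p \<inter> ?F q = {}"
      proof (rule ccontr)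
        assume "?F p \<inter> ?F q \<noteq> {}"
        then obtain x y where "x \<in> C i" "x \<in> C i'" "y \<in> C j" "y \<in> C j'"
          unfolding pq by blast
        thus False using ne disj[OF idx(1,3)] disj[OF idx(2,4)] unfolding pq by simp
      qed
    qed
  qed (simp add: fin\<Delta>)
  hence card: "card (small_factorizations n r z) =
      (\<Sum>i\<in>\<Delta> r. \<Sum>j\<in>\<Delta> r. card (?F (i, j)))"
    by (simp add: card_small_factorizations_inv[OF z] sum.cartesian_product case_prod_beta)
  have "of_nat (card (C i)) * of_nat (card (C j)) / fact n *
      (\<Sum>\<chi>\<in>Irr (symm n).
         class_value \<chi> (C i) * class_value \<chi> (C j) * class_value \<chi> (C s)
           / class_value \<chi> (C 1)) = (of_nat (card (?F (i, j))) :: complex)"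
    if "i \<in> \<Delta> r" "j \<in> \<Delta> r" for i j
  proof -
    have "class_value \<chi> (C s) = \<chi> z" "class_value \<chi> (C 1) = \<chi> \<one>\<^bsub>symm n\<^esub>"
      if "\<chi> \<in> Irr (symm n)" for \<chi>
      using class_value_eq[OF that cls[OF s(1)] s(2)] class_value_eq[OF that cls[of 1] C1] m by auto
    thus ?thesis
      using frobenius_class_product[OF cls[OF \<Delta>[OF that(1)]] cls[OF \<Delta>[OF that(2)]] z]
      by (simp add: card_symm)
  qed
  thus ?thesis by (simp add: card)
qed

lemma ex_transposition:
  assumes "2 \<le> n"
  shows "\<exists>z\<in>carrier (symm n). z \<noteq> \<one>\<^bsub>symm n\<^esub> \<and> card (moved n z) \<le> 2"
proof (rule bexI[of _ "transpose 1 2"], intro conjI)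
  show "transpose 1 2 \<in> carrier (symm n)"
    using assms by (auto simp: carrier_symm intro!: permutes_swap_id)
  show "transpose 1 2 \<noteq> \<one>\<^bsub>symm n\<^esub>"
    unfolding one_symm fun_eq_iff by (auto intro!: exI[of _ 1])
  have "moved n (transpose 1 2) \<subseteq> {1, 2}" by (auto simp: moved_def transpose_def)
  from card_mono[OF _ this] show "card (moved n (transpose 1 2)) \<le> 2" by simp
qed

end

theorem theorem4p2:
  fixes n r m :: nat and C :: "nat \<Rightarrow> (nat \<Rightarrow> nat) set"
  assumes "3 \<le> n" and "2 \<le> r" and "r \<le> n"
    and "bij_betw C {1..m} (conjugacy_classes (symm n))"
    and "\<one>\<^bsub>symm n\<^esub> \<in> C 1"
  shows
    "let \<Delta> = class_indices n m C;
         f = (\<lambda>s. \<Sum>i\<in>\<Delta> r. \<Sum>j\<in>\<Delta> r.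
                of_nat (card (C i)) * of_nat (card (C j)) / fact n *
                (\<Sum>\<chi>\<in>Irr (symm n).
                   class_value \<chi> (C i) * class_value \<chi> (C j) * class_value \<chi> (C s)
                     / class_value \<chi> (C 1)))
     in (\<forall>s \<in> \<Delta> (2 * r) - {1}. f s \<in> \<real>) \<and>
        real (max_ball_intersection n r) = Max ((\<lambda>s. Re (f s)) ` (\<Delta> (2 * r) - {1}))"
proof -
  interpret finite_group "symm n" by (rule finite_group_symm)
  note C = assms(4) and C1 = assms(5)
  define \<Delta> where "\<Delta> = class_indices n m C"
  define f :: "nat \<Rightarrow> complex" where "f = (\<lambda>s. \<Sum>i\<in>\<Delta> r. \<Sum>j\<in>\<Delta> r.
                of_nat (card (C i)) * of_nat (card (C j)) / fact n *
                (\<Sum>\<chi>\<in>Irr (symm n).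
                   class_value \<chi> (C i) * class_value \<chi> (C j) * class_value \<chi> (C s)
                     / class_value \<chi> (C 1)))"
  define I where "I z = card (small_factorizations n r z)" for z
  have cls: "C i \<in> conjugacy_classes (symm n)" if "i \<in> {1..m}" for i
    by (rule bij_betwE[OF C, rule_format, OF that])
  note ex_class = ex_class_index[OF C]
  have m: "1 \<le> m" using ex_class[OF one_closed] by auto
  have f: "f s = of_nat (I z)" if "s \<in> {1..m}" "z \<in> C s" for s z
    unfolding f_def I_def \<Delta>_def by (rule frobenius_class_indices[OF C C1 m that])
  have C1_eq: "C 1 = {\<one>\<^bsub>symm n\<^esub>}"
  proof -
    have "C 1 = (\<lambda>g. g \<otimes>\<^bsub>symm n\<^esub> \<one>\<^bsub>symm n\<^esub> \<otimes>\<^bsub>symm n\<^esub> inv\<^bsub>symm n\<^esub> g) ` carrier (symm n)"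
      using m by (intro conjugacy_class_eq[OF cls C1]) simp
    also have "\<dots> = (\<lambda>g. \<one>\<^bsub>symm n\<^esub>) ` carrier (symm n)" by (intro image_cong refl) simp
    finally show ?thesis using one_closed by auto
  qed
  have rep: "\<exists>z\<in>carrier (symm n) - {\<one>\<^bsub>symm n\<^esub>}. f s = of_nat (I z)" if s: "s \<in> \<Delta> (2 * r) - {1}" for s
  proof -
    have s': "s \<in> {1..m}" "s \<noteq> 1" using s by (auto simp: \<Delta>_def class_indices_def)
    obtain z where z: "z \<in> C s" "z \<in> carrier (symm n)"
      using cls[OF s'(1)] in_own_conjugacy_class unfolding conjugacy_classes_iff by blast
    have "z \<noteq> \<one>\<^bsub>symm n\<^esub>"
    proof
      assume "z = \<one>\<^bsub>symm n\<^esub>"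
      have "C s = C 1"
        using conjugacy_class_eq[OF cls[OF s'(1)] z(1)] conjugacy_class_eq[OF cls[of 1] C1] m
        unfolding \<open>z = \<one>\<^bsub>symm n\<^esub>\<close> by (metis atLeastAtMost_iff order_refl)
      thus False using inj_onD[OF bij_betw_imp_inj_on[OF C], of s 1] s' m by simp
    qed
    thus ?thesis using f[OF s'(1) z(1)] z(2) by auto
  qed
  have ex_s: "\<exists>s\<in>\<Delta> (2 * r) - {1}. f s = of_nat (I z)"
    if z: "z \<in> carrier (symm n)" "z \<noteq> \<one>\<^bsub>symm n\<^esub>" "card (moved n z) \<le> 2 * r" for z
  proof -
    obtain s where s: "s \<in> {1..m}" "z \<in> C s" using ex_class[OF z(1)] by auto
    have "card (moved n y) \<le> 2 * r" if y: "y \<in> C s" for y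
    proof -
      obtain g where "g \<in> carrier (symm n)" "y = g \<otimes>\<^bsub>symm n\<^esub> z \<otimes>\<^bsub>symm n\<^esub> inv\<^bsub>symm n\<^esub> g"
        using y by (subst (asm) conjugacy_class_eq[OF cls[OF s(1)] s(2)]) blast
      thus ?thesis using card_moved_conj[OF z(1)] z(3) by simp
    qed
    moreover have "s \<noteq> 1" using s(2) z(2) C1_eq by auto
    ultimately show ?thesis using f[OF s] s by (auto simp: \<Delta>_def class_indices_def)
  qed
  let ?S = "carrier (symm n) - {\<one>\<^bsub>symm n\<^esub>}"
  have finI: "finite (I ` ?S)" using fin by simp
  obtain t where t: "t \<in> carrier (symm n)" "t \<noteq> \<one>\<^bsub>symm n\<^esub>" "card (moved n t) \<le> 2 * r"
    using ex_transposition[of n] assms(1,2) by force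
  have max: "max_ball_intersection n r = Max (I ` ?S)"
    unfolding max_ball_intersection_eq I_def ..
  have "Max ((\<lambda>s. Re (f s)) ` (\<Delta> (2 * r) - {1})) = real (Max (I ` ?S))"
  proof (rule Max_eqI)
    show "finite ((\<lambda>s. Re (f s)) ` (\<Delta> (2 * r) - {1}))" by (simp add: \<Delta>_def class_indices_def)
    show "y \<le> real (Max (I ` ?S))" if y: "y \<in> (\<lambda>s. Re (f s)) ` (\<Delta> (2 * r) - {1})" for y
    proof -
      obtain s where s: "s \<in> \<Delta> (2 * r) - {1}" "y = Re (f s)" using y by auto
      obtain z where z: "z \<in> ?S" "f s = of_nat (I z)" using rep[OF s(1)] by auto
      have "I z \<le> Max (I ` ?S)" using finI z(1) by (intro Max_ge) auto
      thus ?thesis using s z by simp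
    qed
    have "Max (I ` ?S) \<in> I ` ?S" using finI t by (intro Max_in) auto
    then obtain z where z: "z \<in> ?S" "Max (I ` ?S) = I z" by auto
    \<comment> \<open>A maximizer moving more than \<open>2 * r\<close> points has no factorization at all; the maximum is
      then \<open>0\<close> and any admissible permutation, such as the transposition \<open>t\<close>, attains it.\<close>
    have "\<exists>w\<in>?S. card (moved n w) \<le> 2 * r \<and> I w = I z"
    proof (cases "card (moved n z) \<le> 2 * r")
      case False
      hence "I z = 0" by (simp add: I_def small_factorizations_empty)
      moreover have "I t \<le> Max (I ` ?S)" using finI t by (intro Max_ge) auto
      ultimately show ?thesis using z(2) t by auto
    qed (use z in auto)
    then obtain w where w: "w \<in> ?S" "card (moved n w) \<le> 2 * r" "I w = I z" by blast
    then obtain s where "s \<in> \<Delta> (2 * r) - {1}" "f s = of_nat (I w)" using ex_s[of w] by auto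
    thus "real (Max (I ` ?S)) \<in> (\<lambda>s. Re (f s)) ` (\<Delta> (2 * r) - {1})"
      using z(2) w(3) by (intro image_eqI[of _ _ s]) auto
  qed
  moreover have "f s \<in> \<real>" if "s \<in> \<Delta> (2 * r) - {1}" for s using rep[OF that] by auto
  ultimately have "(\<forall>s \<in> \<Delta> (2 * r) - {1}. f s \<in> \<real>) \<and>
      real (max_ball_intersection n r) = Max ((\<lambda>s. Re (f s)) ` (\<Delta> (2 * r) - {1}))"
    unfolding max by simp
  thus ?thesis unfolding f_def \<Delta>_def Let_def .
qed

end
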